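(* Let $0<\alpha<\tfrac12$, let $L:\mathbb R\to(0,\infty)$ be slowly varying, and let $\mu$ be a probability measure on $\mathbb N$ with $\mu(\{n,n+1,\ldots\})\sim n^{-\alpha}L(n)$ as $n\to\infty$ and $\gcd\{n\in\mathbb N:\mu(\{n\})>0\}=1$. Assume that the renewal weights $q_n$ of $\mu$ satisfy $$q_n\sim\frac{1}{\Gamma(\alpha)\Gamma(1-\alpha)}\,\frac{n^{\alpha-1}}{L(n)}\quad\text{as }n\to\infty.$$ Let $N\in\mathbb N$ be fixed, and consider the long-range seedbank graph on $\mathbb Z\times[N]$ with delay distribution $\mu$. Then for all $k,\ell\in[N]$, $$\mathbf P\left((0,k)\sim(i,\ell)\right)\sim C_{\alpha,N}\,\frac{i^{2\alpha-1}}{L(i)^2}\quad\text{as }i\to\infty,\qquad\text{where}\quad C_{\alpha,N}:=\frac{1}{N+\sum_{m\ge1}q_m^2}\,\frac{\Gamma(1-2\alpha)}{\Gamma(\alpha)\Gamma(1-\alpha)^3}.$$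
   Context: Here $\mathbb N=\{1,2,\ldots\}$ and $[N]=\{1,\ldots,N\}$. Between two real sequences, $f(n)\sim g(n)$ means $f(n)/g(n)\to1$; between vertices, $\sim$ denotes the random equivalence relation defined next. Long-range seedbank graph: the random directed graph $\mathcal G_\mu$ has vertex set $\mathbb Z\times[N]$, and each vertex $(i,k)$ has exactly one outgoing edge, to its parent $(i-R_{i,k},H_{i,k})$, where the $R_{i,k}$ are i.i.d. with distribution $\mu$, the $H_{i,k}$ are i.i.d. uniform on $[N]$, and the two families are independent. $(i,k)\sim(j,\ell)$ means that the two vertices belong to the same connected component of $\mathcal G_\mu$ (edge directions ignored). Renewal weights: $q_n:=\mathbf P(\tilde R_1+\cdots+\tilde R_j=n\text{ for some }j\ge0)$, with $\tilde R_1,\tilde R_2,\ldots$ independent with distribution $\mu$. *)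

theory Defs
  imports "HOL-Probability.Probability" "HOL-Library.Landau_Symbols"
begin

definition slowly_varying :: "(real \<Rightarrow> real) \<Rightarrow> bool" where
  "slowly_varying L \<longleftrightarrow>
     (\<forall>x. L x > 0) \<and> (\<forall>c>0. ((\<lambda>x. L (c * x) / L x) \<longlongrightarrow> 1) at_top)"

text \<open>The i.i.d. sequence of delays is realised as the coordinate process of the infinite product
  measure; the delay called \<open>R\<^sub>1\<close> on paper is the coordinate with index 0. The empty sum
  (\<open>j = 0\<close>) is allowed.\<close>

definition renewal_weight :: "nat pmf \<Rightarrow> nat \<Rightarrow> real" where
  "renewal_weight \<mu> n =
     measure (Pi\<^sub>M UNIV (\<lambda>_::nat. measure_pmf \<mu>)) {r. \<exists>j. (\<Sum>i<j. r i) = n}"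

type_synonym vertex = "int \<times> nat"

definition seedbank_vertices :: "nat \<Rightarrow> vertex set" where
  "seedbank_vertices N = UNIV \<times> {1..N}"

definition seedbank_parent ::
    "(vertex \<Rightarrow> nat) \<Rightarrow> (vertex \<Rightarrow> nat) \<Rightarrow> vertex \<Rightarrow> vertex" where
  "seedbank_parent r h v = (fst v - int (r v), h v)"

definition seedbank_edges ::
    "nat \<Rightarrow> (vertex \<Rightarrow> nat) \<Rightarrow> (vertex \<Rightarrow> nat) \<Rightarrow> (vertex \<times> vertex) set" where
  "seedbank_edges N r h = (\<lambda>v. (v, seedbank_parent r h v)) ` seedbank_vertices N"

definition same_component ::
    "nat \<Rightarrow> (vertex \<Rightarrow> nat) \<Rightarrow> (vertex \<Rightarrow> nat) \<Rightarrow> vertex \<Rightarrow> vertex \<Rightarrow> bool" where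
  "same_component N r h u v \<longleftrightarrow>
     u \<in> seedbank_vertices N \<and> v \<in> seedbank_vertices N \<and>
     (u, v) \<in> (seedbank_edges N r h \<union> (seedbank_edges N r h)\<inverse>)\<^sup>*"

text \<open>The target spaces \<open>{1..}\<close> and \<open>{1..N}\<close> make delays positive and labels lie in \<open>{1..N}\<close>
  at every sample point, so that every realisation is a graph on \<open>seedbank_vertices N\<close>.\<close>

locale long_range_seedbank = prob_space M
  for M :: "'w measure" +
  fixes N :: nat
    and \<mu> :: "nat pmf"
    and R H :: "vertex \<Rightarrow> 'w \<Rightarrow> nat"
  assumes indep_R: "indep_vars (\<lambda>_. count_space {1..}) R (seedbank_vertices N)"
    and distr_R: "\<And>v. v \<in> seedbank_vertices N \<Longrightarrow>
          distr M (count_space UNIV) (R v) = measure_pmf \<mu>"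
    and indep_H: "indep_vars (\<lambda>_. count_space {1..N}) H (seedbank_vertices N)"
    and distr_H: "\<And>v. v \<in> seedbank_vertices N \<Longrightarrow>
          distr M (count_space UNIV) (H v) = measure_pmf (pmf_of_set {1..N})"
    and indep_R_H: "indep_var
          (Pi\<^sub>M (seedbank_vertices N) (\<lambda>_. count_space {1..}))
          (\<lambda>\<omega>. \<lambda>v\<in>seedbank_vertices N. R v \<omega>)
          (Pi\<^sub>M (seedbank_vertices N) (\<lambda>_. count_space {1..N}))
          (\<lambda>\<omega>. \<lambda>v\<in>seedbank_vertices N. H v \<omega>)"

end

theory Submission
  imports Defs "HOL-Real_Asymp.Real_Asymp"
begin

text \<open>Two vertices lie in the same component exactly when their ancestral lines meet, since
  every vertex has a single parent and parents lie strictly in the past. Until the lines meet they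
  explore different vertices and hence behave like two independent lines, which suggests counting
  common vertices. For independent lines started at \<open>(0, k)\<close> and \<open>(i, l)\<close> with \<open>i \<ge> 1\<close>, both visit
  time \<open>- m\<close> with probability \<open>q\<^sub>m q\<^bsub>m+i\<^esub>\<close> and then have the same label with probability
  \<open>1 / N\<close>, so the expected number of common vertices is \<open>(1 / N) \<Sum>\<^sub>m q\<^sub>m q\<^bsub>m+i\<^esub>\<close>. Once they have
  met, the expected number of common vertices, including the first, is
  \<open>1 + (1 / N) \<Sum>\<^bsub>m\<ge>1\<^esub> q\<^sub>m\<^sup>2\<close>. Dividing the two gives the exact formula of \<open>prob_same_component\<close>:
  the lines meet with probability \<open>(\<Sum>\<^sub>m q\<^sub>m q\<^bsub>m+i\<^esub>) / (N + \<Sum>\<^bsub>m\<ge>1\<^esub> q\<^sub>m\<^sup>2)\<close>.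

  The formula is proved through a linear recursion on the given graph. If \<open>v\<close> is the later of
  two distinct vertices, replacing \<open>v\<close> by its parent expresses the probability
  that the lines meet at or above a time \<open>T\<close> through the same probabilities for earlier vertices
  (\<open>prob_meet_event_step\<close>), and the expected number of
  common vertices at or above \<open>T\<close> obeys the same recursion by the renewal equation
  (\<open>green_step\<close>). The recursion does not determine its solution (constants solve it too), but
  with the cut-off at \<open>T\<close> it is well-founded and respects inequalities that hold on the diagonal and
  below the cut-off (\<open>two_line_comparison\<close>). This bounds each of the two quantities by a multiple of
  the other, and the multiples agree as the cut-off tends to \<open>-\<infinity>\<close>.

  The asymptotics come from the convolution sum. Let \<open>W n = 1 / \<mu> {n..}\<close>, so that
  \<open>W n \<sim> n\<^sup>\<alpha> / L n\<close> and \<open>q\<^sub>n \<sim> c W n / n\<close> with \<open>c = 1 / (\<Gamma>(\<alpha>) \<Gamma>(1 - \<alpha>))\<close>. Rescaling the summation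
  index by \<open>i\<close> turns \<open>(i / (W i)\<^sup>2) \<Sum>\<^sub>m q\<^sub>m q\<^bsub>m+i\<^esub>\<close> into the integral of a step function that tends
  pointwise to \<open>c\<^sup>2 x powr (\<alpha> - 1) * (1 + x) powr (\<alpha> - 1)\<close>, whose integral over the half-line is
  \<open>c\<^sup>2 B(\<alpha>, 1 - 2 \<alpha>)\<close>; convergence at infinity is where \<open>\<alpha> < 1/2\<close> enters. The function \<open>L\<close> need not
  be measurable, so uniform convergence and Potter bounds for slowly varying functions cannot be
  applied to it. Both are obtained for \<open>W\<close> instead, from its monotonicity and its ratios along
  integer multiples (\<open>ratio_floor\<close>, \<open>potter_bound\<close>).\<close>

section \<open>The Beta integral over the half-line\<close>

text \<open>The substitution \<open>x = t / (1 - t)\<close> reduces this to the Beta integral over \<open>(0, 1)\<close>.\<close>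

lemma beta_prime_integral:
  fixes a b :: real
  assumes a: "0 < a" and b: "0 < b"
  shows "set_integrable lborel {0<..} (\<lambda>x. x powr (a - 1) * (1 + x) powr (- (a + b)))" (is ?int)
    and "(LBINT x:{0<..}. x powr (a - 1) * (1 + x) powr (- (a + b))) = Beta a b" (is ?val)
proof -
  let ?f = "\<lambda>x::real. x powr (a - 1) * (1 + x) powr (- (a + b))"
  let ?g = "\<lambda>t::real. t / (1 - t)" and ?g' = "\<lambda>t::real. 1 / (1 - t)\<^sup>2"
  let ?h = "\<lambda>t::real. t powr (a - 1) * (1 - t) powr (b - 1)"
  have fg: "?f (?g t) * ?g' t = ?h t" if t: "0 < t" "t < 1" for t
  proof -
    have "1 + ?g t = 1 / (1 - t)" using t by (simp add: field_simps)
    then have "?f (?g t) * ?g' t = (?g t) powr (a - 1) * (1 / (1 - t)) powr (- (a + b)) * ?g' t"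
      by simp
    moreover have "(?g t) powr (a - 1) = t powr (a - 1) * (1 - t) powr (- (a - 1))"
      using t by (subst powr_minus_divide) (simp add: powr_divide)
    moreover have "(1 / (1 - t)) powr (- (a + b)) = (1 - t) powr (a + b)"
      using t by (subst powr_minus_divide) (simp add: powr_divide)
    moreover have "?g' t = (1 - t) powr (- 2)"
      using t by (subst powr_minus_divide) simp
    moreover have "(1 - t) powr (- (a - 1)) * (1 - t) powr (a + b) * (1 - t) powr (- 2) = (1 - t) powr (b - 1)"
      by (simp flip: powr_add)
    ultimately show ?thesis by (metis mult.assoc)
  qed
  have int_h: "set_integrable lborel {0<..<1} ?h"
    by (rule set_integrable_subset[OF integrable_Beta[OF a b]]) auto
  have val_h: "(LBINT t:{0<..<1}. ?h t) = Beta a b"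
    using has_integral_Beta_real[OF a b] set_borel_integral_eq_integral(2)[OF int_h]
    by (simp add: has_integral_Icc_iff_Ioo integral_unique)
  have eq01: "einterval 0 1 = {0<..<1::real}" "einterval 0 \<infinity> = {0::real<..}"
    by (auto simp: einterval_def)
  have pos: "0 < t" "t < 1" if "0 < ereal t" "ereal t < 1" for t using that by auto
  have "((\<lambda>x. ereal (?g x)) \<longlongrightarrow> ereal 0) (at_right 0)"
    by (intro tendsto_intros tendsto_eq_intros) (auto intro!: tendsto_eq_intros)
  then have lim0: "((ereal \<circ> ?g \<circ> real_of_ereal) \<longlongrightarrow> 0) (at_right 0)"
    by (simp add: zero_ereal_def at_right_ereal filterlim_filtermap o_def)
  have "LIM x at_left (1::real). ?g x :> at_top"
  proof (rule LIM_at_top_divide)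
    show "((\<lambda>x::real. x) \<longlongrightarrow> 1) (at_left 1)" by simp
    show "((\<lambda>x::real. 1 - x) \<longlongrightarrow> 0) (at_left 1)" by (auto intro!: tendsto_eq_intros)
    show "\<forall>\<^sub>F x::real in at_left 1. 0 < 1 - x"
      by (auto simp: eventually_at_filter intro: always_eventually)
  qed simp
  then have "((\<lambda>x. ereal (?g x)) \<longlongrightarrow> \<infinity>) (at_left 1)" by (simp add: tendsto_PInfty_eq_at_top)
  then have lim1: "((ereal \<circ> ?g \<circ> real_of_ereal) \<longlongrightarrow> \<infinity>) (at_left 1)"
    by (simp add: one_ereal_def at_left_ereal filterlim_filtermap o_def)
  have int_fg: "set_integrable lborel (einterval 0 1) (\<lambda>x. ?f (?g x) * ?g' x)"
    unfolding eq01 using int_h fg by (subst set_integrable_cong[where M' = lborel and f' = ?h]) auto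
  have d: "DERIV ?g x :> ?g' x" if "0 < ereal x" "ereal x < 1" for x
    using pos[OF that] by (auto intro!: derivative_eq_intros simp: divide_simps power2_eq_square)
  have c1: "isCont ?f (?g x)" if "0 < ereal x" "ereal x < 1" for x
  proof -
    have "0 < ?g x" using pos[OF that] by simp
    then show ?thesis by (intro continuous_intros) auto
  qed
  have c2: "isCont ?g' x" if "0 < ereal x" "ereal x < 1" for x
    using pos[OF that] by (intro continuous_intros) auto
  note subst = interval_integral_substitution_nonneg[of 0 1 ?g ?g' ?f 0 \<infinity>, OF _ d c1 c2 _ _ lim0 lim1 int_fg]
  show ?int using subst(1) by (simp add: eq01)
  have "(LBINT x=0..\<infinity>. ?f x) = (LBINT x=0..1. ?f (?g x) * ?g' x)" using subst(2) by simp
  also have "\<dots> = (LBINT x:{0<..<1}. ?f (?g x) * ?g' x)"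
    by (simp add: interval_lebesgue_integral_def eq01)
  also have "\<dots> = (LBINT x:{0<..<1}. ?h x)"
    using fg by (intro set_lebesgue_integral_cong) auto
  finally show ?val by (simp add: interval_lebesgue_integral_def eq01 val_h)
qed

text \<open>This form of a series lets dominated convergence act on sums whose index is rescaled by \<open>i\<close>.\<close>

lemma step_function_integral:
  fixes g :: "nat \<Rightarrow> real"
  assumes g: "\<And>m. 0 \<le> g m" "summable g" and i: "1 \<le> i"
  shows "(LBINT x:{0<..}. g (nat \<lfloor>x * real i\<rfloor>)) = (\<Sum>m. g m) / i"
proof -
\<comment> \<open>The interval of the points where the step function takes the value \<open>g m\<close>; at \<open>m = 0\<close> it omits the endpoint 0.\<close>
  define A where "A m = (if m = 0 then {0<..<1 / real i} else {real m / i..<(real m + 1) / i})" for m :: nat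
  have A: "x \<in> A m \<longleftrightarrow> 0 < x \<and> nat \<lfloor>x * real i\<rfloor> = m" for x m
  proof -
    have "0 < x \<and> nat \<lfloor>x * real i\<rfloor> = m \<longleftrightarrow> 0 < x \<and> real m \<le> x * i \<and> x * i < real m + 1"
    proof (cases "0 < x")
      case True
      then have "nat \<lfloor>x * real i\<rfloor> = m \<longleftrightarrow> \<lfloor>x * real i\<rfloor> = int m" by auto
      then show ?thesis by (simp add: floor_eq_iff)
    qed simp
    also have "\<dots> \<longleftrightarrow> x \<in> A m"
    proof (cases "m = 0")
      case True
      then show ?thesis using i by (auto simp: A_def field_simps zero_le_mult_iff)
    next
      case False
      have "0 < x" if "real m \<le> x * i"
      proof -
        have "0 < x * i" using that False by linarith
        then show ?thesis using i by (simp add: zero_less_mult_iff)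
      qed
      then show ?thesis using False i by (auto simp: A_def field_simps)
    qed
    finally show ?thesis ..
  qed
  have disj: "disjoint_family A" by (auto simp: disjoint_family_on_def A)
  have meas: "A m \<in> sets lborel" for m by (simp add: A_def)
  have emeas: "emeasure lborel (A m) = ennreal (1 / i)" for m
    using i by (simp add: A_def field_simps)
  have nonneg: "0 \<le> (\<Sum>m. g m) / i" using g by (simp add: suminf_nonneg)
  have "(\<integral>\<^sup>+x. ennreal (indicator {0<..} x *\<^sub>R g (nat \<lfloor>x * real i\<rfloor>)) \<partial>lborel) =
     (\<integral>\<^sup>+x. (\<Sum>m. ennreal (g m) * indicator (A m) x) \<partial>lborel)"
  proof (rule nn_integral_cong)
    fix x :: real
    show "ennreal (indicator {0<..} x *\<^sub>R g (nat \<lfloor>x * real i\<rfloor>)) = (\<Sum>m. ennreal (g m) * indicator (A m) x)"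
    proof (cases "0 < x")
      case True
      then have "x \<in> A (nat \<lfloor>x * real i\<rfloor>)" by (simp add: A)
      from suminf_cmult_indicator[OF disj this, of "\<lambda>m. ennreal (g m)"] show ?thesis
        using True by simp
    qed (simp add: A indicator_def)
  qed
  also have "\<dots> = (\<Sum>m. \<integral>\<^sup>+x. ennreal (g m) * indicator (A m) x \<partial>lborel)"
    using meas by (intro nn_integral_suminf) auto
  also have "\<dots> = (\<Sum>m. ennreal (g m / i))"
    using meas emeas g by (simp add: nn_integral_cmult_indicator flip: ennreal_mult')
  also have "\<dots> = ennreal (\<Sum>m. g m / i)"
    using g by (intro suminf_ennreal_eq summable_sums summable_divide) auto
  also have "(\<Sum>m. g m / i) = (\<Sum>m. g m) / i" by (rule suminf_divide[OF g(2)])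
  finally show ?thesis
    unfolding set_lebesgue_integral_def
    by (subst integral_eq_nn_integral) (use g nonneg in auto)
qed

lemma floor_mult_div_tendsto:
  fixes x :: real
  assumes x: "0 < x"
  shows "(\<lambda>n. real (nat \<lfloor>x * real n\<rfloor>) / real n) \<longlonglongrightarrow> x"
proof (rule tendsto_sandwich[where f = "\<lambda>n. x - 1 / real n" and h = "\<lambda>n. x"])
  show "(\<lambda>n. x - 1 / real n) \<longlonglongrightarrow> x"
    using tendsto_diff[OF tendsto_const[of x] lim_1_over_n] by simp
  show "\<forall>\<^sub>F n in sequentially. x - 1 / real n \<le> real (nat \<lfloor>x * real n\<rfloor>) / real n"
    using eventually_gt_at_top[of 0]
  proof eventually_elim
    case (elim n)
    have "x * n - 1 \<le> real (nat \<lfloor>x * real n\<rfloor>)" using x by (simp add: of_nat_nat)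
    then have "(x * n - 1) / n \<le> real (nat \<lfloor>x * real n\<rfloor>) / n" by (rule divide_right_mono) simp
    then show ?case using elim by (simp add: diff_divide_distrib)
  qed
  show "\<forall>\<^sub>F n in sequentially. real (nat \<lfloor>x * real n\<rfloor>) / real n \<le> x"
    using eventually_gt_at_top[of 0]
    by eventually_elim (use x in \<open>simp add: of_nat_nat field_simps\<close>)
qed simp

lemma floor_mult_at_top:
  fixes x :: real
  assumes x: "0 < x"
  shows "filterlim (\<lambda>n. nat \<lfloor>x * real n\<rfloor>) at_top sequentially"
  unfolding filterlim_at_top
proof
  fix Z :: nat
  have "filterlim (\<lambda>n. x * real n) at_top sequentially"
    using x by (intro filterlim_tendsto_pos_mult_at_top[OF tendsto_const] filterlim_real_sequentially)
  then have "\<forall>\<^sub>F n in sequentially. real Z \<le> x * real n" by (simp add: filterlim_at_top)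
  then show "\<forall>\<^sub>F n in sequentially. Z \<le> nat \<lfloor>x * real n\<rfloor>"
    by eventually_elim (simp add: le_nat_floor)
qed

lemma summable_shifted_product:
  fixes q :: "nat \<Rightarrow> real"
  assumes q: "\<And>n. 0 \<le> q n" and sq: "summable (\<lambda>m. (q m)\<^sup>2)"
  shows "summable (\<lambda>m. q m * q (m + i))"
proof (rule summable_comparison_test')
  show "summable (\<lambda>m. (q m)\<^sup>2 + (q (m + i))\<^sup>2)"
    using sq summable_ignore_initial_segment[OF sq, of i] by (rule summable_add)
  show "norm (q m * q (m + i)) \<le> (q m)\<^sup>2 + (q (m + i))\<^sup>2" for m
  proof -
    have "0 \<le> q m * q (m + i)" using q by simp
    then show ?thesis using sum_squares_bound[of "q m" "q (m + i)"] by (simp del: zero_le_mult_iff)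
  qed
qed

section \<open>Monotone regularly varying sequences\<close>

text \<open>Regular variation with index \<open>\<alpha>\<close> is required along integer multiples only. This is all that the
  behaviour of a tail at the integers gives, and monotonicity supplies the rest.\<close>

locale monotone_regularly_varying =
  fixes W :: "nat \<Rightarrow> real" and \<alpha> :: real
  assumes mono: "mono W"
    and pos: "\<And>n. 0 < W n"
    and ratio: "\<And>c. 1 \<le> c \<Longrightarrow> (\<lambda>n. W (c * n) / W n) \<longlonglongrightarrow> real c powr \<alpha>"
    and \<alpha>_pos: "0 < \<alpha>"
begin

lemma W_mono: "m \<le> n \<Longrightarrow> W m \<le> W n"
  using mono by (rule monoD)

lemma ratio_of_multiples:
  assumes "1 \<le> c" "1 \<le> d"
  shows "(\<lambda>n. W (c * n) / W (d * n)) \<longlonglongrightarrow> (real c / real d) powr \<alpha>"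
proof -
  have "(\<lambda>n. (W (c * n) / W n) / (W (d * n) / W n)) \<longlonglongrightarrow> real c powr \<alpha> / real d powr \<alpha>"
    using assms by (intro tendsto_divide ratio) auto
  moreover have "W n \<noteq> 0" for n using pos[of n] by simp
  ultimately show ?thesis using assms by (simp add: powr_divide)
qed

text \<open>With \<open>j = n div s\<close> and \<open>p\<close> the integer part of \<open>x s\<close>, both \<open>n\<close> and \<open>x n\<close> are squeezed between
  integer multiples of \<open>j\<close>, with factors whose quotient is close to \<open>x\<close> when \<open>s\<close> is large.\<close>

lemma ratio_floor_bounds:
  assumes x: "0 < x" and s: "1 \<le> s" and p: "1 \<le> p" and ps: "p = nat \<lfloor>x * real s\<rfloor>"
  shows "\<forall>\<^sub>F n in sequentially.
      W (p * (n div s)) / W ((s + 1) * (n div s)) \<le> W (nat \<lfloor>x * real n\<rfloor>) / W n \<and>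
      W (nat \<lfloor>x * real n\<rfloor>) / W n \<le> W ((p + 2) * (n div s)) / W (s * (n div s))"
  using eventually_ge_at_top[of "s * (s + p + 1)"]
proof eventually_elim
  case (elim n)
  define j where "j = n div s"
  have j: "s + p + 1 \<le> j" unfolding j_def using elim s by (simp add: less_eq_div_iff_mult_less_eq mult.commute)
  have n1: "s * j \<le> n" by (simp add: j_def)
  have n2: "n < s * (j + 1)" unfolding j_def using s
    by (metis Suc_eq_plus1 dividend_less_times_div less_le_trans mult_Suc_right zero_less_one add.commute)
  have n3: "n \<le> (s + 1) * j" using n2 j by (simp add: algebra_simps)
  have p1: "real p \<le> x * s" and p2: "x * s < real p + 1"
    unfolding ps using x by (auto simp: of_nat_nat)
  have "real (p * j) \<le> x * s * j" using p1 by (simp add: mult_right_mono)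
  also have "\<dots> = x * real (s * j)" by simp
  also have "\<dots> \<le> x * n" using n1 x by (intro mult_left_mono) (auto simp del: of_nat_mult)
  finally have f1: "p * j \<le> nat \<lfloor>x * real n\<rfloor>" by (simp add: le_nat_floor)
  have "x * n \<le> x * real (s * (j + 1))"
    using n2 x by (intro mult_left_mono) (auto simp del: of_nat_mult)
  also have "\<dots> = x * s * (real j + 1)" by (simp add: algebra_simps)
  also have "\<dots> \<le> (real p + 1) * (real j + 1)" using p2 by (intro mult_right_mono) auto
  also have "\<dots> \<le> real ((p + 2) * j)" using j by (simp add: algebra_simps flip: of_nat_mult of_nat_add)
  finally have f2: "nat \<lfloor>x * real n\<rfloor> \<le> (p + 2) * j" by linarith
  show ?case unfolding j_def[symmetric]
    using W_mono[OF f1] W_mono[OF f2] W_mono[OF n1] W_mono[OF n3] pos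
    by (intro conjI frac_le) (auto intro: less_imp_le)
qed

text \<open>First \<open>n\<close> tends to infinity for fixed \<open>s\<close> in the preceding bounds, and then \<open>s\<close> is chosen large
  enough for the prescribed accuracy.\<close>

lemma ratio_floor:
  assumes x: "0 < x"
  shows "(\<lambda>n. W (nat \<lfloor>x * real n\<rfloor>) / W n) \<longlonglongrightarrow> x powr \<alpha>"
proof -
  define p where "p s = nat \<lfloor>x * real s\<rfloor>" for s :: nat
  have p_lim: "(\<lambda>s. real (p s) / real s) \<longlonglongrightarrow> x"
    unfolding p_def by (rule floor_mult_div_tendsto[OF x])
  have p_ge: "\<forall>\<^sub>F s in sequentially. 1 \<le> p s"
    using floor_mult_at_top[OF x] unfolding p_def filterlim_at_top by blast
  have s_lim: "(\<lambda>s. real (s + 1) / real s) \<longlonglongrightarrow> 1" "(\<lambda>s. 2 / real s) \<longlonglongrightarrow> 0"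
    by real_asymp+
  have "(\<lambda>s. (real (p s) / real s) / (real (s + 1) / real s)) \<longlonglongrightarrow> x / 1"
    by (intro tendsto_divide p_lim s_lim) simp
  then have low: "(\<lambda>s. ((real (p s) / real s) / (real (s + 1) / real s)) powr \<alpha>) \<longlonglongrightarrow> x powr \<alpha>"
    using x by (auto intro!: tendsto_powr)
  have "(\<lambda>s. real (p s) / real s + 2 / real s) \<longlonglongrightarrow> x + 0"
    by (intro tendsto_add p_lim s_lim)
  then have up: "(\<lambda>s. (real (p s) / real s + 2 / real s) powr \<alpha>) \<longlonglongrightarrow> x powr \<alpha>"
    using x by (auto intro!: tendsto_powr)
  have div_lim: "filterlim (\<lambda>n. n div s) sequentially sequentially" if "1 \<le> s" for s :: nat
    unfolding filterlim_at_top
  proof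
    fix Z
    show "\<forall>\<^sub>F n in sequentially. Z \<le> n div s"
      using eventually_ge_at_top[of "s * Z"]
      by eventually_elim (use that in \<open>simp add: less_eq_div_iff_mult_less_eq mult.commute\<close>)
  qed
  show ?thesis
  proof (rule order_tendstoI)
    fix a assume "a < x powr \<alpha>"
    then have "\<forall>\<^sub>F s in sequentially. a < ((real (p s) / real s) / (real (s + 1) / real s)) powr \<alpha> \<and> 1 \<le> p s \<and> 1 \<le> s"
      using order_tendstoD(1)[OF low] p_ge eventually_ge_at_top by (intro eventually_conj) auto
    then obtain s where s: "a < ((real (p s) / real s) / (real (s + 1) / real s)) powr \<alpha>" "1 \<le> p s" "1 \<le> s"
      using eventually_happens by fastforce
    have "(\<lambda>n. W (p s * (n div s)) / W ((s + 1) * (n div s))) \<longlonglongrightarrow> (real (p s) / real (s + 1)) powr \<alpha>"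
      using filterlim_compose[OF ratio_of_multiples[OF s(2)] div_lim[OF s(3)], of "s + 1"] by simp
    moreover have "a < (real (p s) / real (s + 1)) powr \<alpha>" using s by simp
    ultimately have "\<forall>\<^sub>F n in sequentially. a < W (p s * (n div s)) / W ((s + 1) * (n div s))"
      by (rule order_tendstoD(1))
    with ratio_floor_bounds[OF x s(3,2) p_def]
    show "\<forall>\<^sub>F n in sequentially. a < W (nat \<lfloor>x * real n\<rfloor>) / W n"
      by eventually_elim linarith
  next
    fix a assume "x powr \<alpha> < a"
    then have "\<forall>\<^sub>F s in sequentially. (real (p s) / real s + 2 / real s) powr \<alpha> < a \<and> 1 \<le> p s \<and> 1 \<le> s"
      using order_tendstoD(2)[OF up] p_ge eventually_ge_at_top by (intro eventually_conj) auto
    then obtain s where s: "(real (p s) / real s + 2 / real s) powr \<alpha> < a" "1 \<le> p s" "1 \<le> s"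
      using eventually_happens by fastforce
    have "(\<lambda>n. W ((p s + 2) * (n div s)) / W (s * (n div s))) \<longlonglongrightarrow> (real (p s + 2) / real s) powr \<alpha>"
      using filterlim_compose[OF ratio_of_multiples[of "p s + 2" s] div_lim[OF s(3)]] s by simp
    moreover have "(real (p s + 2) / real s) powr \<alpha> < a" using s by (simp add: add_divide_distrib add.commute)
    ultimately have "\<forall>\<^sub>F n in sequentially. W ((p s + 2) * (n div s)) / W (s * (n div s)) < a"
      by (rule order_tendstoD(2))
    with ratio_floor_bounds[OF x s(3,2) p_def]
    show "\<forall>\<^sub>F n in sequentially. W (nat \<lfloor>x * real n\<rfloor>) / W n < a"
      by eventually_elim linarith
  qed
qed


lemma doubling_bounds:
  assumes "\<gamma> < \<alpha>" "\<alpha> < \<beta>"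
  obtains n0 where "1 \<le> n0"
    and "\<And>n. n0 \<le> n \<Longrightarrow> 2 powr \<gamma> * W n \<le> W (2 * n)"
    and "\<And>n. n0 \<le> n \<Longrightarrow> W (2 * n) \<le> 2 powr \<beta> * W n"
proof -
  have "2 powr \<gamma> < 2 powr \<alpha>" "2 powr \<alpha> < 2 powr \<beta>" using assms by auto
  then have "\<forall>\<^sub>F n in sequentially. 2 powr \<gamma> < W (2 * n) / W n \<and> W (2 * n) / W n < 2 powr \<beta> \<and> 1 \<le> n"
    using order_tendstoD[OF ratio[of 2]] eventually_ge_at_top by (intro eventually_conj) auto
  then obtain n0 where n0: "\<And>n. n0 \<le> n \<Longrightarrow> 2 powr \<gamma> < W (2 * n) / W n \<and> W (2 * n) / W n < 2 powr \<beta> \<and> 1 \<le> n"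
    unfolding eventually_sequentially by blast
  show thesis
  proof
    show "1 \<le> n0" using n0[of n0] by simp
    show "2 powr \<gamma> * W n \<le> W (2 * n)" "W (2 * n) \<le> 2 powr \<beta> * W n" if "n0 \<le> n" for n
      using n0[OF that] pos[of n] by (auto simp: field_simps)
  qed
qed

lemma iterated_doubling_bounds:
  assumes n: "1 \<le> n" "n \<le> m" and step: "\<And>k. n \<le> k \<Longrightarrow> 2 powr \<gamma> * W k \<le> W (2 * k)" "\<And>k. n \<le> k \<Longrightarrow> W (2 * k) \<le> 2 powr \<beta> * W k"
  shows "2 powr (\<gamma> * real k) * W m \<le> W (2 ^ k * m) \<and> W (2 ^ k * m) \<le> 2 powr (\<beta> * real k) * W m"
proof (induction k)
  case (Suc k)
  have le: "n \<le> 2 ^ k * m" using n by (metis le_trans mult_1 mult_le_mono1 one_le_numeral one_le_power)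
  have eq: "2 ^ Suc k * m = 2 * (2 ^ k * m)" by simp
  have "2 powr (\<gamma> * real (Suc k)) * W m = 2 powr \<gamma> * (2 powr (\<gamma> * real k) * W m)"
    by (simp add: powr_add algebra_simps)
  also have "\<dots> \<le> 2 powr \<gamma> * W (2 ^ k * m)" using Suc by (intro mult_left_mono) auto
  also have "\<dots> \<le> W (2 ^ Suc k * m)" unfolding eq by (rule step(1)[OF le])
  finally have 1: "2 powr (\<gamma> * real (Suc k)) * W m \<le> W (2 ^ Suc k * m)" .
  have "W (2 ^ Suc k * m) \<le> 2 powr \<beta> * W (2 ^ k * m)" unfolding eq by (rule step(2)[OF le])
  also have "\<dots> \<le> 2 powr \<beta> * (2 powr (\<beta> * real k) * W m)" using Suc by (intro mult_left_mono) auto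
  also have "\<dots> = 2 powr (\<beta> * real (Suc k)) * W m" by (simp add: powr_add algebra_simps)
  finally show ?case using 1 by blast
qed simp

text \<open>Monotonicity compares \<open>W n\<close> with the values of \<open>W\<close> at the neighbouring multiples \<open>2\<^sup>k m\<close>. A crude
  common constant serves both bounds.\<close>

lemma potter_bound_large:
  assumes \<gamma>: "0 \<le> \<gamma>" "\<gamma> \<le> \<beta>" and n0: "1 \<le> n0"
    and step: "\<And>k. n0 \<le> k \<Longrightarrow> 2 powr \<gamma> * W k \<le> W (2 * k)" "\<And>k. n0 \<le> k \<Longrightarrow> W (2 * k) \<le> 2 powr \<beta> * W k"
    and m: "n0 \<le> m" "m \<le> n"
  shows "W n \<le> 2 powr \<beta> * W m * (real n / m) powr \<beta>"
    and "W m \<le> 2 powr \<beta> * W n * (real m / n) powr \<gamma>"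
proof -
  have m0: "1 \<le> m" using m n0 by simp
  have "1 \<le> n div m" using m m0 by (simp add: less_eq_div_iff_mult_less_eq)
  then obtain k where k: "2 ^ k \<le> n div m" "n div m < 2 ^ (k + 1)"
    using ex_power_ivl1[of 2 "n div m"] by auto
  have lo: "2 ^ k * m \<le> n" using k(1) m0 by (simp add: less_eq_div_iff_mult_less_eq)
  have hi: "n < 2 ^ (k + 1) * m" using k(2) m0 by (simp add: div_less_iff_less_mult)
  note sc = iterated_doubling_bounds[OF n0 m(1) step]
  have r1: "2 powr real k \<le> real n / m"
  proof -
    have "2 ^ k * real m \<le> real n" using lo
      by (metis of_nat_le_iff of_nat_mult of_nat_numeral of_nat_power)
    then show ?thesis using m0 by (simp add: powr_realpow pos_le_divide_eq)
  qed
  have r2: "real n / m \<le> 2 powr (real k + 1)"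
  proof -
    have "real n < real (2 ^ (k + 1) * m)" using hi by (simp only: of_nat_less_iff)
    then have "real n < 2 ^ (k + 1) * real m" by (simp only: of_nat_mult of_nat_power of_nat_numeral)
    moreover have "2 powr (real k + 1) = 2 ^ (k + 1)" by (simp add: powr_add powr_realpow)
    ultimately show ?thesis using m0 by (simp add: pos_divide_le_eq)
  qed
  have "W n \<le> W (2 ^ (k + 1) * m)" using hi by (intro W_mono) simp
  also have "\<dots> \<le> 2 powr (\<beta> * real (k + 1)) * W m" using sc by blast
  also have "2 powr (\<beta> * real (k + 1)) = 2 powr \<beta> * (2 powr real k) powr \<beta>"
    by (simp add: powr_powr powr_add algebra_simps)
  also have "\<dots> * W m \<le> 2 powr \<beta> * (real n / m) powr \<beta> * W m"
    using r1 \<gamma> pos[of m] by (intro mult_right_mono mult_left_mono powr_mono2) auto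
  finally show "W n \<le> 2 powr \<beta> * W m * (real n / m) powr \<beta>" by (simp add: mult_ac)
  have "2 powr (\<gamma> * real k) * W m \<le> W n"
    using sc W_mono[OF lo] by (meson order_trans)
  have inv: "2 powr (- real k - 1) \<le> real m / n"
  proof -
    have "2 powr (- real k - 1) = inverse (2 powr (real k + 1))" by (simp add: powr_minus[symmetric])
    also have "\<dots> \<le> inverse (real n / m)" using r2 m m0 by (intro le_imp_inverse_le) auto
    finally show ?thesis by (simp add: inverse_eq_divide)
  qed
  have "W m = 2 powr (- (\<gamma> * real k)) * (2 powr (\<gamma> * real k) * W m)"
    by (simp add: mult.assoc[symmetric] flip: powr_add)
  also have "\<dots> \<le> 2 powr (- (\<gamma> * real k)) * W n"
    using \<open>2 powr (\<gamma> * real k) * W m \<le> W n\<close> by (intro mult_left_mono) auto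
  also have "2 powr (- (\<gamma> * real k)) = 2 powr \<gamma> * (2 powr (- real k - 1)) powr \<gamma>"
    by (simp add: powr_powr algebra_simps flip: powr_add)
  also have "\<dots> * W n \<le> 2 powr \<beta> * (real m / n) powr \<gamma> * W n"
    using inv \<gamma> pos[of n] by (intro mult_right_mono mult_mono powr_mono2) auto
  finally show "W m \<le> 2 powr \<beta> * W n * (real m / n) powr \<gamma>" by (simp add: mult_ac)
qed

text \<open>Potter's bound. The sum of the two powers covers \<open>m \<le> n\<close> and \<open>n \<le> m\<close> at once, and the constant
  \<open>C\<close> absorbs the finitely many indices at which the doubling bounds fail: raising \<open>m\<close> and \<open>n\<close> to
  at least \<open>n0\<close> changes \<open>W m\<close> and the ratio \<open>n / m\<close> by bounded factors only.\<close>

lemma potter_bound: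
  assumes "0 \<le> \<gamma>" "\<gamma> < \<alpha>" "\<alpha> < \<beta>"
  obtains C where "0 < C"
    "\<And>m n. 1 \<le> m \<Longrightarrow> 1 \<le> n \<Longrightarrow> W n \<le> C * W m * ((real n / m) powr \<beta> + (real n / m) powr \<gamma>)"
proof -
  obtain n0 where n0: "1 \<le> n0"
    "\<And>n. n0 \<le> n \<Longrightarrow> 2 powr \<gamma> * W n \<le> W (2 * n)" "\<And>n. n0 \<le> n \<Longrightarrow> W (2 * n) \<le> 2 powr \<beta> * W n"
    using doubling_bounds[OF assms(2,3)] by blast
  define K where "K = W n0 / W 1"
  define C where "C = 2 powr \<beta> * K * real n0 powr \<beta>"
  have K: "1 \<le> K" unfolding K_def using W_mono[OF n0(1)] pos[of 1] by simp
  have C0: "0 < C" unfolding C_def using K n0(1) by simp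
  have "W n \<le> C * W m * ((real n / m) powr \<beta> + (real n / m) powr \<gamma>)" if mn: "1 \<le> m" "1 \<le> n" for m n
  proof -
    define m' n' where "m' = max m n0" and "n' = max n n0"
    have ge: "n0 \<le> m'" "n0 \<le> n'" "m \<le> m'" "n \<le> n'" by (auto simp: m'_def n'_def)
    have n': "n' \<le> n0 * n" unfolding n'_def using mn n0(1) by simp
    have Wm': "W m' \<le> K * W m"
    proof (cases "n0 \<le> m")
      case True
      then show ?thesis using K pos[of m] by (simp add: m'_def max_def)
    next
      case False
      have "W n0 = K * W 1" unfolding K_def using pos[of 1] by simp
      also have "\<dots> \<le> K * W m" using K mn W_mono[of 1 m] by (intro mult_left_mono) auto
      finally show ?thesis using False by (simp add: m'_def max_def)
    qed
    have r: "real n' / m' \<le> real n0 * (real n / m)"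
    proof -
      have "real n' / m' \<le> real (n0 * n) / m"
        using n' ge mn by (intro frac_le) (auto simp del: of_nat_mult)
      then show ?thesis by simp
    qed
    have bound: "W n \<le> C * W m * (real n / m) powr e"
      if e: "0 \<le> e" "e \<le> \<beta>" and *: "W n' \<le> 2 powr \<beta> * W m' * (real n' / m') powr e" for e
    proof -
      have "W n \<le> W n'" by (rule W_mono[OF ge(4)])
      also note *
      also have "2 powr \<beta> * W m' * (real n' / m') powr e \<le> 2 powr \<beta> * (K * W m) * (real n0 * (real n / m)) powr e"
        using Wm' r e pos[of m'] pos[of m] K by (intro mult_mono powr_mono2) (auto intro: less_imp_le)
      also have "(real n0 * (real n / m)) powr e = real n0 powr e * (real n / m) powr e"
        by (rule powr_mult)
      also have "2 powr \<beta> * (K * W m) * (real n0 powr e * (real n / m) powr e) \<le>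
          2 powr \<beta> * (K * W m) * (real n0 powr \<beta> * (real n / m) powr e)"
        using e n0(1) K pos[of m]
        by (intro mult_left_mono mult_right_mono powr_mono) (auto intro: less_imp_le)
      finally show ?thesis by (simp add: C_def mult_ac)
    qed
    consider "m' \<le> n'" | "n' \<le> m'" by linarith
    then show ?thesis
    proof cases
      case 1
      have "W n \<le> C * W m * (real n / m) powr \<beta>"
        using assms by (intro bound potter_bound_large(1)[OF _ _ n0 ge(1) 1]) auto
      also have "\<dots> \<le> C * W m * ((real n / m) powr \<beta> + (real n / m) powr \<gamma>)"
        using C0 pos[of m] by (intro mult_left_mono) auto
      finally show ?thesis .
    next
      case 2
      have "W n \<le> C * W m * (real n / m) powr \<gamma>"
        using assms by (intro bound potter_bound_large(2)[OF _ _ n0 ge(2) 2]) auto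
      also have "\<dots> \<le> C * W m * ((real n / m) powr \<beta> + (real n / m) powr \<gamma>)"
        using C0 pos[of m] by (intro mult_left_mono) auto
      finally show ?thesis .
    qed
  qed
  with C0 that show thesis by blast
qed


section \<open>Convolution of a sequence with its own shift\<close>

text \<open>The integrable majorant. Comparing \<open>q m\<close> with \<open>W (m + 1) / (m + 1)\<close> rather than \<open>W m / m\<close>
  includes \<open>m = 0\<close>, and as the integer \<open>\<lfloor>x i\<rfloor> + 1\<close> exceeds \<open>x i\<close>, the negative powers of it are
  bounded by those of \<open>x i\<close>.\<close>

lemma scaled_sequence_bound:
  fixes q :: "nat \<Rightarrow> real"
  assumes q: "\<And>n. 0 \<le> q n" and lim: "(\<lambda>n. q n * real n / W n) \<longlonglongrightarrow> c"
    and \<gamma>\<beta>: "0 < \<gamma>" "\<gamma> < \<alpha>" "\<alpha> < \<beta>" "\<beta> < 1"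
  obtains C where "0 < C"
    "\<And>i x. 1 \<le> i \<Longrightarrow> 0 < x \<Longrightarrow>
       q (nat \<lfloor>x * real i\<rfloor>) * i / W i \<le> C * (x powr (\<beta> - 1) + x powr (\<gamma> - 1))"
proof -
  obtain B0 where B0: "0 < B0" "\<And>n. norm (q n * real n / W n) \<le> B0"
    using Bseq_def[THEN iffD1, OF convergent_imp_Bseq[OF convergentI[OF lim]]] by blast
  obtain C0 where C0: "0 < C0"
    "\<And>m n. 1 \<le> m \<Longrightarrow> 1 \<le> n \<Longrightarrow> W n \<le> C0 * W m * ((real n / m) powr \<beta> + (real n / m) powr \<gamma>)"
    using potter_bound[of \<gamma> \<beta>] \<gamma>\<beta> by (metis less_imp_le)
  define B where "B = 2 * B0 + q 0 / W 1"
  have B: "0 < B" unfolding B_def using B0(1) q[of 0] pos[of 1]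
    by (intro add_pos_nonneg divide_nonneg_pos) auto
  have qB: "q m \<le> B * (W (Suc m) / real (Suc m))" for m
  proof (cases "m = 0")
    case True
    have "q 0 = q 0 / W 1 * (W 1 / 1)" using pos[of 1] by simp
    also have "\<dots> \<le> B * (W 1 / 1)" unfolding B_def
      using B0(1) pos[of 1] by (intro mult_right_mono) auto
    finally show ?thesis using True by simp
  next
    case False
    have "q m * m / W m \<le> B0" using B0(2)[of m] unfolding real_norm_def by (rule abs_le_D1)
    then have "q m \<le> B0 * (W m / m)" using pos[of m] False by (simp add: field_simps)
    also have "\<dots> \<le> B0 * (2 * (W (Suc m) / real (Suc m)))"
    proof (intro mult_left_mono)
      have "W m / m \<le> W (Suc m) / m" using W_mono[of m "Suc m"] by (intro divide_right_mono) auto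
      also have "\<dots> \<le> W (Suc m) / (real (Suc m) / 2)"
        using False pos[of "Suc m"] by (intro divide_left_mono) auto
      finally show "W m / m \<le> 2 * (W (Suc m) / real (Suc m))" by (simp add: mult.commute)
    qed (use B0(1) in simp)
    also have "\<dots> = 2 * B0 * (W (Suc m) / real (Suc m))" by simp
    also have "\<dots> \<le> B * (W (Suc m) / real (Suc m))"
      unfolding B_def using q[of 0] pos[of 1] pos[of "Suc m"]
      by (intro mult_right_mono) (auto intro!: divide_nonneg_pos)
    finally show ?thesis .
  qed
  have "q (nat \<lfloor>x * real i\<rfloor>) * i / W i \<le> B * C0 * (x powr (\<beta> - 1) + x powr (\<gamma> - 1))"
    if i: "1 \<le> i" and x: "0 < x" for i x
  proof -
    define n where "n = Suc (nat \<lfloor>x * real i\<rfloor>)"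
    have xn: "x * i < n" unfolding n_def using x by (simp add: of_nat_nat) linarith
    have y: "x \<le> real n / i" "0 < real n / i" using xn i by (auto simp: field_simps n_def)
    have "q (nat \<lfloor>x * real i\<rfloor>) * i / W i \<le> B * (W n / n) * i / W i"
      using qB[of "nat \<lfloor>x * real i\<rfloor>"] pos[of i] unfolding n_def
      by (intro divide_right_mono mult_right_mono) auto
    also have "\<dots> \<le> B * (C0 * W i * ((real n / i) powr \<beta> + (real n / i) powr \<gamma>) / n) * i / W i"
      using C0(2)[OF i, of n] B pos[of i]
      by (intro divide_right_mono mult_right_mono mult_left_mono) (auto simp: n_def)
    also have "\<dots> = B * C0 * (((real n / i) powr \<beta> + (real n / i) powr \<gamma>) / (real n / i))"
    proof -
      have "B * (C0 * W i * y / n) * i / W i = B * C0 * (y / (real n / i))" for y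
        using pos[of i] by simp
      then show ?thesis .
    qed
    also have "((real n / i) powr \<beta> + (real n / i) powr \<gamma>) / (real n / i) =
        (real n / i) powr (\<beta> - 1) + (real n / i) powr (\<gamma> - 1)"
      using y(2) by (simp only: powr_diff powr_one add_divide_distrib less_imp_le)
    also have "B * C0 * \<dots> \<le> B * C0 * (x powr (\<beta> - 1) + x powr (\<gamma> - 1))"
      using y \<gamma>\<beta> x B C0(1) by (intro mult_left_mono add_mono powr_mono2') auto
    finally show ?thesis .
  qed
  with B C0(1) that[of "B * C0"] show thesis by simp
qed

lemma scaled_sequence_tendsto:
  fixes q :: "nat \<Rightarrow> real"
  assumes lim: "(\<lambda>n. q n * real n / W n) \<longlonglongrightarrow> c" and x: "0 < x"
  shows "(\<lambda>i. q (nat \<lfloor>x * real i\<rfloor>) * i / W i) \<longlonglongrightarrow> c * x powr (\<alpha> - 1)"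
proof -
  define n where "n i = nat \<lfloor>x * real i\<rfloor>" for i :: nat
  have n: "filterlim n at_top sequentially"
    unfolding n_def by (rule floor_mult_at_top[OF x])
  have "(\<lambda>i. (q (n i) * real (n i) / W (n i)) * (W (n i) / W i) / (real (n i) / real i)) \<longlonglongrightarrow> c * x powr \<alpha> / x"
    using x unfolding n_def
    by (intro tendsto_divide tendsto_mult ratio_floor floor_mult_div_tendsto
        filterlim_compose[OF lim floor_mult_at_top]) auto
  moreover have "\<forall>\<^sub>F i in sequentially. (q (n i) * real (n i) / W (n i)) * (W (n i) / W i) / (real (n i) / real i)
      = q (n i) * i / W i"
  proof -
    have "\<forall>\<^sub>F i in sequentially. 1 \<le> n i" using n unfolding filterlim_at_top by blast
    then show ?thesis
    proof eventually_elim
      case (elim i)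
      then show ?case using pos[of "n i"] by (simp add: field_simps)
    qed
  qed
  moreover have "c * x powr \<alpha> / x = c * x powr (\<alpha> - 1)" using x by (simp add: powr_diff)
  ultimately show ?thesis unfolding n_def by (auto intro: Lim_transform_eventually)
qed

lemma summable_square:
  fixes q :: "nat \<Rightarrow> real"
  assumes q: "\<And>n. 0 \<le> q n" and lim: "(\<lambda>n. q n * real n / W n) \<longlonglongrightarrow> c" and \<alpha>: "\<alpha> < 1 / 2"
  shows "summable (\<lambda>m. (q m)\<^sup>2)"
proof -
  define \<beta> where "\<beta> = (\<alpha> + 1 / 2) / 2"
  obtain C where C: "0 < C" "\<And>i x. 1 \<le> i \<Longrightarrow> 0 < x \<Longrightarrow>
       q (nat \<lfloor>x * real i\<rfloor>) * i / W i \<le> C * (x powr (\<beta> - 1) + x powr (\<alpha> / 2 - 1))"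
    using scaled_sequence_bound[OF q lim, of "\<alpha> / 2" \<beta>] \<alpha> \<alpha>_pos by (auto simp: \<beta>_def field_simps)
  show ?thesis
  proof (rule summable_comparison_test'[where N = 1])
    show "summable (\<lambda>m. (W 1 * C * 2)\<^sup>2 * real m powr (2 * \<beta> - 2))"
      using \<alpha> by (intro summable_mult) (simp add: summable_real_powr_iff \<beta>_def)
    fix m :: nat assume m: "1 \<le> m"
    have "q m / W 1 \<le> C * (real m powr (\<beta> - 1) + real m powr (\<alpha> / 2 - 1))"
      using C(2)[of 1 "real m"] m by simp
    also have "\<dots> \<le> C * (2 * real m powr (\<beta> - 1))"
    proof (intro mult_left_mono)
      have "real m powr (\<alpha> / 2 - 1) \<le> real m powr (\<beta> - 1)"
        using m \<alpha> \<alpha>_pos by (intro powr_mono) (auto simp: \<beta>_def)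
      then show "real m powr (\<beta> - 1) + real m powr (\<alpha> / 2 - 1) \<le> 2 * real m powr (\<beta> - 1)" by simp
    qed (use C in simp)
    finally have "q m \<le> W 1 * C * 2 * real m powr (\<beta> - 1)" using pos[of 1] by (simp add: field_simps)
    then have "(q m)\<^sup>2 \<le> (W 1 * C * 2 * real m powr (\<beta> - 1))\<^sup>2" using q by (intro power_mono) auto
    also have "\<dots> = (W 1 * C * 2)\<^sup>2 * real m powr (2 * \<beta> - 2)"
      using m by (simp add: power_mult_distrib power2_eq_square[of "real m powr (\<beta> - 1)"] flip: powr_add)
    finally show "norm ((q m)\<^sup>2) \<le> (W 1 * C * 2)\<^sup>2 * real m powr (2 * \<beta> - 2)" by simp
  qed
qed

text \<open>Since \<open>i\<close> is an integer, \<open>\<lfloor>(1 + x) i\<rfloor> = \<lfloor>x i\<rfloor> + i\<close>, so the rescaled summand is the product of the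
  same rescaled sequence at \<open>x\<close> and at \<open>1 + x\<close>; its limit and its majorant are thus products of
  those already known.\<close>

theorem shifted_convolution_tendsto:
  fixes q :: "nat \<Rightarrow> real"
  assumes q: "\<And>n. 0 \<le> q n" and lim: "(\<lambda>n. q n * real n / W n) \<longlonglongrightarrow> c" and \<alpha>: "\<alpha> < 1 / 2"
  shows "(\<lambda>i. (\<Sum>m. q m * q (m + i)) * real i / (W i)\<^sup>2) \<longlonglongrightarrow> c\<^sup>2 * Beta \<alpha> (1 - 2 * \<alpha>)"
proof -
\<comment> \<open>The majorant behaves like \<open>x powr (2 \<beta> - 2)\<close> at infinity and \<open>x powr (\<gamma> - 1)\<close> at 0, so \<open>\<beta> < 1/2\<close> and \<open>\<gamma> > 0\<close> make it integrable.\<close>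
  define \<beta> \<gamma> where "\<beta> = (\<alpha> + 1 / 2) / 2" and "\<gamma> = \<alpha> / 2"
  have \<gamma>\<beta>: "0 < \<gamma>" "\<gamma> < \<alpha>" "\<alpha> < \<beta>" "\<beta> < 1 / 2"
    using \<alpha> \<alpha>_pos by (auto simp: \<beta>_def \<gamma>_def)
  define h where "h i x = q (nat \<lfloor>x * real i\<rfloor>) * i / W i" for i :: nat and x :: real
  define b where "b x = x powr (\<beta> - 1) + x powr (\<gamma> - 1)" for x :: real
  obtain C where C: "0 < C" "\<And>i x. 1 \<le> i \<Longrightarrow> 0 < x \<Longrightarrow> h i x \<le> C * b x"
    using scaled_sequence_bound[OF q lim, of \<gamma> \<beta>] \<gamma>\<beta> unfolding h_def b_def by auto
  have h0: "0 \<le> h i x" for i x unfolding h_def using q pos[of i] by (auto intro!: divide_nonneg_pos)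
  have [measurable]: "h i \<in> borel_measurable borel" for i unfolding h_def by measurable
  let ?S = "\<lambda>i x. indicator {0<..} x *\<^sub>R (h (Suc i) x * h (Suc i) (1 + x))"
  let ?F = "\<lambda>x. indicator {0<..} x *\<^sub>R (c\<^sup>2 * (x powr (\<alpha> - 1) * (1 + x) powr (- (\<alpha> + (1 - 2 * \<alpha>)))))"
  let ?w = "\<lambda>x. indicator {0<..} x *\<^sub>R (C * b x * (C * b (1 + x)))"
  have "(\<lambda>i. integral\<^sup>L lborel (?S i)) \<longlonglongrightarrow> integral\<^sup>L lborel ?F"
  proof (rule integral_dominated_convergence[where w = ?w])
    have *: "set_integrable lborel {0<..} (\<lambda>x. x powr (s - 1) * (1 + x) powr (t - 1))"
      if "0 < s" "s < 1 / 2" "t < 1 / 2" for s t :: real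
      using beta_prime_integral(1)[of s "1 - t - s"] that by (simp add: algebra_simps)
    have "set_integrable lborel {0<..} (\<lambda>x. C * C * (
        (x powr (\<beta> - 1) * (1 + x) powr (\<beta> - 1) + x powr (\<beta> - 1) * (1 + x) powr (\<gamma> - 1)) +
        (x powr (\<gamma> - 1) * (1 + x) powr (\<beta> - 1) + x powr (\<gamma> - 1) * (1 + x) powr (\<gamma> - 1))))"
      using \<gamma>\<beta> by (intro set_integral_add set_integrable_mult_right *) auto
    then show "integrable lborel ?w"
      unfolding set_integrable_def b_def by (simp add: algebra_simps)
    show "AE x in lborel. (\<lambda>i. ?S i x) \<longlonglongrightarrow> ?F x"
    proof (intro AE_I2)
      fix x :: real
      show "(\<lambda>i. ?S i x) \<longlonglongrightarrow> ?F x"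
      proof (cases "0 < x")
        case True
        have "(\<lambda>i. h i x * h i (1 + x)) \<longlonglongrightarrow> (c * x powr (\<alpha> - 1)) * (c * (1 + x) powr (\<alpha> - 1))"
          unfolding h_def using True by (intro tendsto_mult scaled_sequence_tendsto[OF lim]) auto
        then have "(\<lambda>i. h (Suc i) x * h (Suc i) (1 + x)) \<longlonglongrightarrow> (c * x powr (\<alpha> - 1)) * (c * (1 + x) powr (\<alpha> - 1))"
          by (rule LIMSEQ_Suc)
        then show ?thesis using True by (simp add: power2_eq_square mult_ac)
      qed simp
    qed
    show "AE x in lborel. norm (?S i x) \<le> ?w x" for i
    proof (intro AE_I2)
      fix x :: real
      show "norm (?S i x) \<le> ?w x"
      proof (cases "0 < x")
        case True
        then have "h (Suc i) x * h (Suc i) (1 + x) \<le> C * b x * (C * b (1 + x))"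
          using C(1) by (intro mult_mono C(2) h0) (auto simp: b_def)
        then show ?thesis using True h0 by (simp add: abs_mult)
      qed simp
    qed
  qed measurable
  also have "integral\<^sup>L lborel ?F = c\<^sup>2 * Beta \<alpha> (1 - 2 * \<alpha>)"
    using beta_prime_integral(2)[of \<alpha> "1 - 2 * \<alpha>"] \<alpha> \<alpha>_pos
    unfolding set_lebesgue_integral_def
    by (simp only: scaleR_conv_of_real mult.left_commute[of _ "c\<^sup>2"] integral_mult_right_zero)
  also have "(\<lambda>i. integral\<^sup>L lborel (?S i)) = (\<lambda>i. (\<Sum>m. q m * q (m + Suc i)) * real (Suc i) / (W (Suc i))\<^sup>2)"
  proof
    fix i' :: nat
    define i where "i = Suc i'"
    have i: "1 \<le> i" by (simp add: i_def)
    have sum: "summable (\<lambda>m. q m * q (m + i))"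
      by (rule summable_shifted_product[OF q summable_square[OF q lim \<alpha>]])
    have shift: "nat \<lfloor>(1 + x) * real i\<rfloor> = nat \<lfloor>x * real i\<rfloor> + i" if "0 < x" for x
    proof -
      have "(1 + x) * real i = x * real i + of_int (int i)" by (simp add: algebra_simps)
      then have "\<lfloor>(1 + x) * real i\<rfloor> = \<lfloor>x * real i\<rfloor> + int i" by (simp only: floor_add_int)
      then show ?thesis using that by (simp add: nat_add_distrib)
    qed
    have "integral\<^sup>L lborel (?S i') =
        (LBINT x:{0<..}. (i / W i)\<^sup>2 * (q (nat \<lfloor>x * real i\<rfloor>) * q (nat \<lfloor>x * real i\<rfloor> + i)))"
      unfolding set_lebesgue_integral_def
      by (intro Bochner_Integration.integral_cong refl)
        (auto simp: h_def shift power2_eq_square indicator_def simp flip: i_def)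
    also have "\<dots> = (i / W i)\<^sup>2 * (LBINT x:{0<..}. q (nat \<lfloor>x * real i\<rfloor>) * q (nat \<lfloor>x * real i\<rfloor> + i))"
      by (rule set_integral_mult_right)
    also have "(LBINT x:{0<..}. q (nat \<lfloor>x * real i\<rfloor>) * q (nat \<lfloor>x * real i\<rfloor> + i)) = (\<Sum>m. q m * q (m + i)) / i"
      using q sum i by (intro step_function_integral[where g = "\<lambda>m. q m * q (m + i)"]) auto
    also have "(i / W i)\<^sup>2 * ((\<Sum>m. q m * q (m + i)) / i) = (\<Sum>m. q m * q (m + i)) * i / (W i)\<^sup>2"
      using i by (simp add: power2_eq_square)
    finally show "integral\<^sup>L lborel (?S i') = (\<Sum>m. q m * q (m + Suc i')) * real (Suc i') / (W (Suc i'))\<^sup>2"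
      unfolding i_def .
  qed
  finally show ?thesis by (rule LIMSEQ_imp_Suc)
qed

end

section \<open>Ancestral lines\<close>

abbreviation ancestor :: "(vertex \<Rightarrow> nat) \<Rightarrow> (vertex \<Rightarrow> nat) \<Rightarrow> nat \<Rightarrow> vertex \<Rightarrow> vertex" where
  "ancestor r h m u \<equiv> (seedbank_parent r h ^^ m) u"

definition lines_meet_above ::
    "int \<Rightarrow> (vertex \<Rightarrow> nat) \<Rightarrow> (vertex \<Rightarrow> nat) \<Rightarrow> vertex \<Rightarrow> vertex \<Rightarrow> bool" where
  "lines_meet_above T r h u v \<longleftrightarrow>
     (\<exists>m n. ancestor r h m u = ancestor r h n v \<and> T \<le> fst (ancestor r h m u))"

definition seedbank_config :: "nat \<Rightarrow> (vertex \<Rightarrow> nat) \<Rightarrow> (vertex \<Rightarrow> nat) \<Rightarrow> bool" where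
  "seedbank_config N r h \<longleftrightarrow> (\<forall>v\<in>seedbank_vertices N. 1 \<le> r v \<and> h v \<in> {1..N})"

lemma parent_in_vertices:
  "seedbank_config N r h \<Longrightarrow> u \<in> seedbank_vertices N \<Longrightarrow> seedbank_parent r h u \<in> seedbank_vertices N"
  unfolding seedbank_vertices_def seedbank_parent_def seedbank_config_def by auto

lemma ancestor_in_vertices:
  "seedbank_config N r h \<Longrightarrow> u \<in> seedbank_vertices N \<Longrightarrow> ancestor r h m u \<in> seedbank_vertices N"
  by (induction m) (auto intro: parent_in_vertices)

lemma ancestor_time_le:
  assumes "seedbank_config N r h" "u \<in> seedbank_vertices N"
  shows "fst (ancestor r h m u) \<le> fst u - int m"
proof (induction m)
  case (Suc m)
  have "1 \<le> r (ancestor r h m u)"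
    using ancestor_in_vertices[OF assms, of m] assms(1) unfolding seedbank_config_def by blast
  then show ?case using Suc by (simp add: seedbank_parent_def[of r h "ancestor r h m u"])
qed simp

text \<open>The relation that two lines meet is carried along each edge, whichever of its endpoints is the
  parent. The cut-offs \<open>- n\<close> exhaust all times.\<close>

lemma same_component_iff_lines_meet:
  assumes cfg: "seedbank_config N r h" and u: "u \<in> seedbank_vertices N" and v: "v \<in> seedbank_vertices N"
  shows "same_component N r h u v \<longleftrightarrow> (\<exists>n. lines_meet_above (- int n) r h u v)"
proof -
  let ?E = "seedbank_edges N r h" and ?f = "seedbank_parent r h"
  have E: "(x, y) \<in> ?E \<longleftrightarrow> x \<in> seedbank_vertices N \<and> y = ?f x" for x y
    unfolding seedbank_edges_def by auto
  have up: "(w, ancestor r h m w) \<in> ?E\<^sup>*" if "w \<in> seedbank_vertices N" for w m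
  proof (induction m)
    case (Suc m)
    have "(ancestor r h m w, ancestor r h (Suc m) w) \<in> ?E"
      using ancestor_in_vertices[OF cfg that] by (simp add: E)
    with Suc show ?case by (rule rtrancl_into_rtrancl)
  qed simp
  have "(\<exists>m n. ancestor r h m u = ancestor r h n y)" if "(u, y) \<in> (?E \<union> ?E\<inverse>)\<^sup>*" for y
    using that
  proof (induction rule: rtrancl_induct)
    case base
    show ?case by blast
  next
    case (step x y)
    then obtain m n where mn: "ancestor r h m u = ancestor r h n x" by blast
    from step(2) consider "y = ?f x" | "x = ?f y" by (auto simp: E)
    then show ?case
    proof cases
      case 1
      have "ancestor r h (Suc m) u = ancestor r h (Suc n) x" using mn by simp
      also have "\<dots> = ancestor r h n y" unfolding 1 by (simp only: funpow_Suc_right o_apply)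
      finally show ?thesis by blast
    next
      case 2
      have "ancestor r h m u = ancestor r h (Suc n) y"
        using mn unfolding 2 by (simp only: funpow_Suc_right o_apply)
      then show ?thesis by blast
    qed
  qed
  moreover have "(u, v) \<in> (?E \<union> ?E\<inverse>)\<^sup>*" if "ancestor r h m u = ancestor r h n v" for m n
  proof -
    have "(u, ancestor r h m u) \<in> (?E \<union> ?E\<inverse>)\<^sup>*" 
      using up[OF u] by (rule rtrancl_mono[THEN subsetD, rotated]) auto
    moreover have "(ancestor r h n v, v) \<in> (?E\<inverse>)\<^sup>*" using up[OF v] by (simp add: rtrancl_converse)
    then have "(ancestor r h n v, v) \<in> (?E \<union> ?E\<inverse>)\<^sup>*"
      by (rule rtrancl_mono[THEN subsetD, rotated]) auto
    ultimately show ?thesis using that by (metis rtrancl_trans)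
  qed
  moreover have "\<exists>n. - int n \<le> x" for x :: int by (rule exI[of _ "nat (- x)"]) auto
  ultimately show ?thesis
    unfolding same_component_def lines_meet_above_def using u v by blast
qed

lemma lines_meet_above_refl: "T \<le> fst u \<Longrightarrow> lines_meet_above T r h u u"
  unfolding lines_meet_above_def by (metis funpow_0)

lemma lines_meet_above_sym: "lines_meet_above T r h u v \<longleftrightarrow> lines_meet_above T r h v u"
  unfolding lines_meet_above_def by metis

lemma not_lines_meet_above:
  assumes "seedbank_config N r h" "u \<in> seedbank_vertices N" "v \<in> seedbank_vertices N"
    and "fst u < T \<or> fst v < T"
  shows "\<not> lines_meet_above T r h u v"
  using ancestor_time_le[OF assms(1,2)] ancestor_time_le[OF assms(1,3)] assms(4)
  unfolding lines_meet_above_def by (smt (verit) of_nat_0_le_iff)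

text \<open>The line of \<open>u\<close> never passes through \<open>v\<close>, being strictly older than \<open>u\<close> after its first vertex, so
  a common ancestor of \<open>u\<close> and \<open>v\<close> is a proper ancestor of \<open>v\<close>.\<close>

lemma lines_meet_above_step:
  assumes cfg: "seedbank_config N r h" and u: "u \<in> seedbank_vertices N" and "u \<noteq> v" "fst u \<le> fst v"
  shows "lines_meet_above T r h u v \<longleftrightarrow> lines_meet_above T r h u (seedbank_parent r h v)"
proof
  assume "lines_meet_above T r h u v"
  then obtain m n where mn: "ancestor r h m u = ancestor r h n v" "T \<le> fst (ancestor r h m u)"
    unfolding lines_meet_above_def by blast
  show "lines_meet_above T r h u (seedbank_parent r h v)"
  proof (cases n)
    case 0
    then have "fst v \<le> fst u - int m" using mn ancestor_time_le[OF cfg u, of m] by simp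
    with \<open>fst u \<le> fst v\<close> have "m = 0" by simp
    with mn 0 \<open>u \<noteq> v\<close> show ?thesis by simp
  next
    case (Suc n')
    then show ?thesis using mn unfolding lines_meet_above_def
      by (metis funpow_Suc_right o_apply)
  qed
next
  assume "lines_meet_above T r h u (seedbank_parent r h v)"
  then obtain m n where "ancestor r h m u = ancestor r h n (seedbank_parent r h v)"
     "T \<le> fst (ancestor r h m u)"
    unfolding lines_meet_above_def by blast
  moreover have "ancestor r h n (seedbank_parent r h v) = ancestor r h (Suc n) v"
    by (simp only: funpow_Suc_right o_apply)
  ultimately show "lines_meet_above T r h u v" unfolding lines_meet_above_def by metis
qed

text \<open>The vertices other than \<open>v\<close> that lines started no later than \<open>v\<close> can use before they fall
  below \<open>T\<close>. The set is finite, so events that depend on it only are measurable, and it omits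
  \<open>v\<close>, so they are independent of the delay and label of \<open>v\<close>.\<close>

definition window :: "nat \<Rightarrow> int \<Rightarrow> vertex \<Rightarrow> vertex set" where
  "window N T v = ({T..fst v} \<times> {1..N}) - {v}"

lemma window_finite: "finite (window N T v)"
  and window_subset: "window N T v \<subseteq> seedbank_vertices N"
  and not_in_window: "v \<notin> window N T v"
  by (auto simp: window_def seedbank_vertices_def)

lemma ancestor_cong_window:
  assumes cfg: "seedbank_config N r h" and cfg': "seedbank_config N r' h'"
    and eq: "\<And>w. w \<in> window N T v \<Longrightarrow> r w = r' w \<and> h w = h' w"
    and x: "x \<in> seedbank_vertices N" "x \<noteq> v" "fst x \<le> fst v"
    and T: "T \<le> fst (ancestor r h m x)"
  shows "ancestor r' h' m x = ancestor r h m x"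
  using T
proof (induction m)
  case (Suc m)
  let ?y = "ancestor r h m x"
  have y: "?y \<in> seedbank_vertices N" by (rule ancestor_in_vertices[OF cfg x(1)])
  have le: "fst ?y \<le> fst x - int m" by (rule ancestor_time_le[OF cfg x(1)])
  have "?y \<noteq> v" using le x by (cases m) auto
  moreover have "T \<le> fst ?y" using Suc.prems by (simp add: seedbank_parent_def[of r h ?y])
  ultimately have "?y \<in> window N T v" using y le x
    unfolding window_def seedbank_vertices_def by (cases ?y) auto
  then show ?case using Suc.IH \<open>T \<le> fst ?y\<close> eq[of ?y]
    by (simp add: seedbank_parent_def[of _ _ ?y])
qed simp

lemma lines_meet_above_cong_window:
  assumes cfg: "seedbank_config N r h" and cfg': "seedbank_config N r' h'"
    and eq: "\<And>w. w \<in> window N T v \<Longrightarrow> r w = r' w \<and> h w = h' w"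
    and u: "u \<in> seedbank_vertices N" "u \<noteq> v" "fst u \<le> fst v"
    and x: "x \<in> seedbank_vertices N" "x \<noteq> v" "fst x \<le> fst v"
  shows "lines_meet_above T r h u x \<longleftrightarrow> lines_meet_above T r' h' u x"
proof -
  have eq': "\<And>w. w \<in> window N T v \<Longrightarrow> r' w = r w \<and> h' w = h w" using eq by auto
  note c1 = ancestor_cong_window[OF cfg cfg' eq] and c2 = ancestor_cong_window[OF cfg' cfg eq']
  show ?thesis unfolding lines_meet_above_def
    using c1[OF _ u] c1[OF _ x] c2[OF _ u] c2[OF _ x] by metis
qed

section \<open>Independence of one step of a line from the past\<close>

context long_range_seedbank
begin

abbreviation "V \<equiv> seedbank_vertices N"

lemma R_measurable: "v \<in> V \<Longrightarrow> R v \<in> M \<rightarrow>\<^sub>M count_space {1..}"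
  using indep_R by (auto simp: indep_vars_def)

lemma H_measurable: "v \<in> V \<Longrightarrow> H v \<in> M \<rightarrow>\<^sub>M count_space {1..N}"
  using indep_H by (auto simp: indep_vars_def)

lemma config: "\<omega> \<in> space M \<Longrightarrow> seedbank_config N (\<lambda>v. R v \<omega>) (\<lambda>v. H v \<omega>)"
  unfolding seedbank_config_def
  using measurable_space[OF R_measurable] measurable_space[OF H_measurable] by force

lemma R_measurable_UNIV: "v \<in> V \<Longrightarrow> R v \<in> M \<rightarrow>\<^sub>M count_space UNIV"
  by (rule measurable_compose[OF R_measurable, of _ "\<lambda>x. x"]) simp_all

lemma H_measurable_UNIV: "v \<in> V \<Longrightarrow> H v \<in> M \<rightarrow>\<^sub>M count_space UNIV"
  by (rule measurable_compose[OF H_measurable, of _ "\<lambda>x. x"]) simp_all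

lemma R_event: "v \<in> V \<Longrightarrow> R v -` A \<inter> space M \<in> events"
  using measurable_sets[OF R_measurable_UNIV] by simp

lemma H_event: "v \<in> V \<Longrightarrow> H v -` A \<inter> space M \<in> events"
  using measurable_sets[OF H_measurable_UNIV] by simp

lemma R_range: "v \<in> V \<Longrightarrow> \<omega> \<in> space M \<Longrightarrow> 1 \<le> R v \<omega>"
  and H_range: "v \<in> V \<Longrightarrow> \<omega> \<in> space M \<Longrightarrow> H v \<omega> \<in> {1..N}"
  using config unfolding seedbank_config_def by blast+

lemma prob_R: "v \<in> V \<Longrightarrow> prob (R v -` {a} \<inter> space M) = pmf \<mu> a"
  using measure_distr[OF R_measurable_UNIV, of v "{a}"] distr_R[of v]
  by (simp add: pmf.rep_eq)

lemma prob_H: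
  assumes "v \<in> V" "b \<in> {1..N}"
  shows "prob (H v -` {b} \<inter> space M) = 1 / N"
proof -
  have "prob (H v -` {b} \<inter> space M) = pmf (pmf_of_set {1..N}) b"
    using measure_distr[OF H_measurable_UNIV, of v "{b}"] distr_H[of v] assms(1)
    by (simp add: measure_pmf_single)
  also have "\<dots> = 1 / N" using assms(2) by (subst pmf_of_set) auto
  finally show ?thesis .
qed

abbreviation "ranges \<equiv> case_sum (\<lambda>_::vertex. count_space {1::nat..}) (\<lambda>_::vertex. count_space {1..N})"

text \<open>The delays and the labels are merged into one independent family, indexed by a disjoint sum, so
  that the variables at one vertex can be separated from all variables in a window.\<close>

lemma indep_delays_labels: "indep_vars ranges (case_sum R H) (V <+> V)"
  unfolding indep_vars_def2
proof (intro conjI ballI)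
  fix x assume "x \<in> V <+> V"
  then show "random_variable (ranges x) (case_sum R H x)"
    using R_measurable H_measurable by auto
next
  show "indep_sets (\<lambda>i. {case_sum R H i -` A \<inter> space M |A. A \<in> sets (ranges i)}) (V <+> V)"
  proof (rule indep_setsI)
    fix x assume "x \<in> V <+> V"
    then show "{case_sum R H x -` A \<inter> space M |A. A \<in> sets (ranges x)} \<subseteq> events"
      using R_event H_event by auto
  next
    fix A :: "vertex + vertex \<Rightarrow> 'w set" and J
    assume J: "J \<noteq> {}" "J \<subseteq> V <+> V" "finite J"
      and A: "\<forall>j\<in>J. A j \<in> {case_sum R H j -` A \<inter> space M |A. A \<in> sets (ranges j)}"
    then obtain B where B: "\<And>j. j \<in> J \<Longrightarrow> A j = case_sum R H j -` B j \<inter> space M"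
      "\<And>j. j \<in> J \<Longrightarrow> B j \<in> sets (ranges j)"
      by (force simp: bchoice_iff)
    define J1 J2 where "J1 = Inl -` J" and "J2 = Inr -` J"
    have fin: "finite J1" "finite J2"
      unfolding J1_def J2_def using J(3) by (auto intro: finite_vimageI)
    have sub: "J1 \<subseteq> V" "J2 \<subseteq> V" using J(2) unfolding J1_def J2_def by auto
    have JJ: "J = Inl ` J1 \<union> Inr ` J2"
    proof -
      have "x \<in> Inl ` J1 \<union> Inr ` J2" if "x \<in> J" for x
        using that unfolding J1_def J2_def by (cases x) auto
      then show ?thesis unfolding J1_def J2_def by auto
    qed
\<comment> \<open>The intersection splits into an event on delays and an event on labels; independence of the two fields separates them.\<close>
    define E1 where "E1 = {\<omega> \<in> space M. \<forall>j\<in>J1. R j \<omega> \<in> B (Inl j)}"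
    define E2 where "E2 = {\<omega> \<in> space M. \<forall>j\<in>J2. H j \<omega> \<in> B (Inr j)}"
    have p1: "prob E1 = (\<Prod>j\<in>J1. prob (A (Inl j)))"
    proof (cases "J1 = {}")
      case False
      have "E1 = (\<Inter>j\<in>J1. R j -` B (Inl j) \<inter> space M)" using False by (auto simp: E1_def)
      also have "prob \<dots> = (\<Prod>j\<in>J1. prob (R j -` B (Inl j) \<inter> space M))"
        by (rule indep_varsD[OF indep_R]) (use False fin sub B(2) in \<open>force simp: J1_def\<close>)+
      also have "\<dots> = (\<Prod>j\<in>J1. prob (A (Inl j)))"
        using B(1) by (intro prod.cong) (auto simp: J1_def)
      finally show ?thesis .
    qed (simp add: E1_def prob_space)
    have p2: "prob E2 = (\<Prod>j\<in>J2. prob (A (Inr j)))"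
    proof (cases "J2 = {}")
      case False
      have "E2 = (\<Inter>j\<in>J2. H j -` B (Inr j) \<inter> space M)" using False by (auto simp: E2_def)
      also have "prob \<dots> = (\<Prod>j\<in>J2. prob (H j -` B (Inr j) \<inter> space M))"
        by (rule indep_varsD[OF indep_H]) (use False fin sub B(2) in \<open>force simp: J2_def\<close>)+
      also have "\<dots> = (\<Prod>j\<in>J2. prob (A (Inr j)))"
        using B(1) by (intro prod.cong) (auto simp: J2_def)
      finally show ?thesis .
    qed (simp add: E2_def prob_space)
    let ?XR = "\<lambda>\<omega>. \<lambda>v\<in>V. R v \<omega>" and ?XH = "\<lambda>\<omega>. \<lambda>v\<in>V. H v \<omega>"
    let ?C1 = "{f \<in> space (Pi\<^sub>M V (\<lambda>_. count_space {1::nat..})). \<forall>j\<in>J1. f j \<in> B (Inl j)}"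
    let ?C2 = "{f \<in> space (Pi\<^sub>M V (\<lambda>_. count_space {1..N})). \<forall>j\<in>J2. f j \<in> B (Inr j)}"
    have C1: "?C1 \<in> sets (Pi\<^sub>M V (\<lambda>_. count_space {1::nat..}))"
    proof (rule sets.sets_Collect_finite_All[OF _ fin(1)])
      fix j assume "j \<in> J1"
      with sub have "(\<lambda>f. f j) -` B (Inl j) \<inter> space (Pi\<^sub>M V (\<lambda>_. count_space {1::nat..}))
          \<in> sets (Pi\<^sub>M V (\<lambda>_. count_space {1::nat..}))"
        using B(2)[of "Inl j"] unfolding J1_def
        by (intro measurable_sets[OF measurable_component_singleton]) auto
      then show "{f \<in> space (Pi\<^sub>M V (\<lambda>_. count_space {1::nat..})). f j \<in> B (Inl j)}
          \<in> sets (Pi\<^sub>M V (\<lambda>_. count_space {1::nat..}))"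
        by (simp add: vimage_def Int_def conj_commute)
    qed
    have C2: "?C2 \<in> sets (Pi\<^sub>M V (\<lambda>_. count_space {1..N}))"
    proof (rule sets.sets_Collect_finite_All[OF _ fin(2)])
      fix j assume "j \<in> J2"
      with sub have "(\<lambda>f. f j) -` B (Inr j) \<inter> space (Pi\<^sub>M V (\<lambda>_. count_space {1..N}))
          \<in> sets (Pi\<^sub>M V (\<lambda>_. count_space {1..N}))"
        using B(2)[of "Inr j"] unfolding J2_def
        by (intro measurable_sets[OF measurable_component_singleton]) auto
      then show "{f \<in> space (Pi\<^sub>M V (\<lambda>_. count_space {1..N})). f j \<in> B (Inr j)}
          \<in> sets (Pi\<^sub>M V (\<lambda>_. count_space {1..N}))"
        by (simp add: vimage_def Int_def conj_commute)
    qed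
    have XR: "?XR -` ?C1 \<inter> space M = E1"
    proof -
      have "?XR \<omega> \<in> space (Pi\<^sub>M V (\<lambda>_. count_space {1::nat..}))" if "\<omega> \<in> space M" for \<omega>
        using R_range[OF _ that] by (auto simp: space_PiM)
      moreover have "?XR \<omega> j = R j \<omega>" if "j \<in> J1" for j \<omega> using that sub by auto
      ultimately show ?thesis unfolding E1_def by auto
    qed
    have XH: "?XH -` ?C2 \<inter> space M = E2"
    proof -
      have "?XH \<omega> \<in> space (Pi\<^sub>M V (\<lambda>_. count_space {1..N}))" if "\<omega> \<in> space M" for \<omega>
        using H_range[OF _ that] by (auto simp: space_PiM)
      moreover have "?XH \<omega> j = H j \<omega>" if "j \<in> J2" for j \<omega> using that sub by auto
      ultimately show ?thesis unfolding E2_def by auto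
    qed
    have "(\<Inter>j\<in>J. A j) = {\<omega> \<in> space M. \<forall>j\<in>J. case_sum R H j \<omega> \<in> B j}"
      using J(1) B(1) by auto
    also have "\<dots> = E1 \<inter> E2" unfolding E1_def E2_def JJ by (auto simp: ball_Un)
    also have "\<dots> = (\<lambda>\<omega>. (?XR \<omega>, ?XH \<omega>)) -` (?C1 \<times> ?C2) \<inter> space M"
      unfolding XR[symmetric] XH[symmetric] by auto
    also have "prob \<dots> = prob E1 * prob E2"
      unfolding indep_varD[OF indep_R_H C1 C2] XR XH ..
    also have "prob E1 * prob E2 = (\<Prod>j\<in>J. prob (A j))"
      unfolding JJ p1 p2 using fin 
      by (subst prod.union_disjoint) (auto simp: prod.reindex inj_on_def)
    finally show "prob (\<Inter>j\<in>J. A j) = (\<Prod>j\<in>J. prob (A j))" .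
  qed
qed


definition meet_event :: "int \<Rightarrow> vertex \<Rightarrow> vertex \<Rightarrow> 'w set" where
  "meet_event T u v = {\<omega> \<in> space M. lines_meet_above T (\<lambda>v. R v \<omega>) (\<lambda>v. H v \<omega>) u v}"

abbreviation window_values :: "vertex set \<Rightarrow> 'w \<Rightarrow> vertex + vertex \<Rightarrow> nat" where
  "window_values W \<omega> \<equiv> restrict (\<lambda>i. case_sum R H i \<omega>) (W <+> W)"

text \<open>The values in the window are extended by 1 outside of it to a configuration of the whole graph;
  the lines above \<open>T\<close> do not see the difference.\<close>

lemma meet_event_window:
  assumes u: "u \<in> V" "u \<noteq> v" "fst u \<le> fst v" and x: "x \<in> V" "x \<noteq> v" "fst x \<le> fst v"
  obtains S where "S \<in> sets (Pi\<^sub>M (window N T v <+> window N T v) ranges)"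
    and "meet_event T u x = window_values (window N T v) -` S \<inter> space M"
proof -
  let ?W = "window N T v"
  let ?B = "case_sum (\<lambda>_::vertex. {1::nat..}) (\<lambda>_::vertex. {1..N})"
  have ranges_eq: "ranges = (\<lambda>i. count_space (?B i))" by (auto simp: fun_eq_iff split: sum.splits)
  have sets_PiM: "sets (Pi\<^sub>M (?W <+> ?W) ranges) = Pow (PiE (?W <+> ?W) ?B)"
    unfolding ranges_eq using window_finite[of N T v]
    by (subst count_space_PiM_finite) (auto split: sum.splits)
  define rf where "rf f w = (if w \<in> ?W then f (Inl w) else (1::nat))" for f :: "vertex + vertex \<Rightarrow> nat" and w
  define hf where "hf f w = (if w \<in> ?W then f (Inr w) else (1::nat))" for f :: "vertex + vertex \<Rightarrow> nat" and w
  define S where "S = {f \<in> PiE (?W <+> ?W) ?B. lines_meet_above T (rf f) (hf f) u x}"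
  have N: "1 \<le> N" using u(1) by (auto simp: seedbank_vertices_def)
  have vals: "window_values ?W \<omega> \<in> PiE (?W <+> ?W) ?B" if "\<omega> \<in> space M" for \<omega>
    using R_range[OF _ that] H_range[OF _ that] window_subset[of N T v]
    by (force simp: InlI InrI split: sum.splits)
  have "meet_event T u x = window_values ?W -` S \<inter> space M"
  proof -
    have "lines_meet_above T (\<lambda>v. R v \<omega>) (\<lambda>v. H v \<omega>) u x \<longleftrightarrow>
        lines_meet_above T (rf (window_values ?W \<omega>)) (hf (window_values ?W \<omega>)) u x"
      if \<omega>: "\<omega> \<in> space M" for \<omega>
    proof (rule lines_meet_above_cong_window[OF config[OF \<omega>] _ _ u x])
      have "1 \<le> R w \<omega> \<and> H w \<omega> \<in> {1..N}" if "w \<in> ?W" for w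
        using R_range[OF _ \<omega>] H_range[OF _ \<omega>] that window_subset[of N T v] by blast
      then show "seedbank_config N (rf (window_values ?W \<omega>)) (hf (window_values ?W \<omega>))"
        unfolding seedbank_config_def rf_def hf_def using N by (auto simp: InlI InrI)
    next
      fix w assume "w \<in> ?W"
      then show "R w \<omega> = rf (window_values ?W \<omega>) w \<and> H w \<omega> = hf (window_values ?W \<omega>) w"
        unfolding rf_def hf_def by (auto simp: InlI InrI)
    qed
    then show ?thesis using vals unfolding meet_event_def S_def by auto
  qed
  moreover have "S \<in> sets (Pi\<^sub>M (?W <+> ?W) ranges)" unfolding sets_PiM S_def by auto
  ultimately show thesis using that by blast
qed

lemma meet_event_sets:
  assumes "u \<in> V" "x \<in> V"
  shows "meet_event T u x \<in> events"
proof -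
\<comment> \<open>A vertex later than both, so that omitting it from its window loses nothing.\<close>
  define v where "v = (max (fst u) (fst x) + 1, 1::nat)"
  have v: "u \<noteq> v" "fst u \<le> fst v" "x \<noteq> v" "fst x \<le> fst v"
    unfolding v_def by (cases u; cases x; auto)+
  obtain S where S: "S \<in> sets (Pi\<^sub>M (window N T v <+> window N T v) ranges)"
     "meet_event T u x = window_values (window N T v) -` S \<inter> space M"
    using meet_event_window[OF assms(1) v(1,2) assms(2) v(3,4)] by blast
  have "window_values (window N T v) \<in> M \<rightarrow>\<^sub>M Pi\<^sub>M (window N T v <+> window N T v) ranges"
    using window_subset[of N T v] R_measurable H_measurable
    by (intro measurable_restrict) (auto split: sum.splits)
  then show ?thesis unfolding S(2) using S(1) by (rule measurable_sets)
qed

lemma prob_step_meet_event: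
  assumes u: "u \<in> V" "u \<noteq> v" "fst u \<le> fst v" and x: "x \<in> V" "x \<noteq> v" "fst x \<le> fst v"
    and v: "v \<in> V" and a: "1 \<le> a" and b: "b \<in> {1..N}"
  shows "prob {\<omega> \<in> meet_event T u x. R v \<omega> = a \<and> H v \<omega> = b} =
    pmf \<mu> a / N * prob (meet_event T u x)"
proof -
  let ?W = "window N T v"
  obtain S where S: "S \<in> sets (Pi\<^sub>M (?W <+> ?W) ranges)"
     "meet_event T u x = window_values ?W -` S \<inter> space M"
    using meet_event_window[OF u x] by blast
  let ?X = "\<lambda>\<omega>. restrict (\<lambda>i. case_sum R H i \<omega>) ({v} <+> {v})"
  have ind: "indep_var (Pi\<^sub>M ({v} <+> {v}) ranges) ?X (Pi\<^sub>M (?W <+> ?W) ranges) (window_values ?W)"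
    by (rule indep_var_restrict[OF indep_delays_labels]) (use window_subset[of N T v] not_in_window v in auto)
  define Q where "Q = (\<lambda>f. f (Inl v)) -` {a} \<inter> (\<lambda>f. f (Inr v)) -` {b} 
      \<inter> space (Pi\<^sub>M ({v} <+> {v}) ranges)"
  have Q: "Q \<in> sets (Pi\<^sub>M ({v} <+> {v}) ranges)"
  proof -
    have "(\<lambda>f. f (Inl v)) -` {a} \<inter> space (Pi\<^sub>M ({v} <+> {v}) ranges) \<in> sets (Pi\<^sub>M ({v} <+> {v}) ranges)"
      by (rule measurable_sets[OF measurable_component_singleton]) (use a in auto)
    moreover have "(\<lambda>f. f (Inr v)) -` {b} \<inter> space (Pi\<^sub>M ({v} <+> {v}) ranges) \<in> sets (Pi\<^sub>M ({v} <+> {v}) ranges)"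
      by (rule measurable_sets[OF measurable_component_singleton]) (use b in auto)
    ultimately have "((\<lambda>f. f (Inl v)) -` {a} \<inter> space (Pi\<^sub>M ({v} <+> {v}) ranges)) \<inter> 
       ((\<lambda>f. f (Inr v)) -` {b} \<inter> space (Pi\<^sub>M ({v} <+> {v}) ranges)) \<in> sets (Pi\<^sub>M ({v} <+> {v}) ranges)"
      by (rule sets.Int)
    then show ?thesis unfolding Q_def by (simp add: Int_ac)
  qed
  have X: "?X \<omega> \<in> space (Pi\<^sub>M ({v} <+> {v}) ranges)" if "\<omega> \<in> space M" for \<omega>
    using R_range[OF v that] H_range[OF v that]
    by (auto simp: space_PiM split: sum.splits)
  have XQ: "?X -` Q \<inter> space M = {\<omega> \<in> space M. R v \<omega> = a \<and> H v \<omega> = b}"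
    using X by (auto simp: Q_def InlI InrI)
  have "prob (?X -` Q \<inter> space M) = 
     prob (\<Inter>i\<in>{Inl v, Inr v}. case_sum R H i -` (case_sum (\<lambda>_. {a}) (\<lambda>_. {b}) i) \<inter> space M)"
    unfolding XQ by (rule arg_cong[where f = prob]) auto
  also have "\<dots> = (\<Prod>i\<in>{Inl v, Inr v}. prob (case_sum R H i -` (case_sum (\<lambda>_. {a}) (\<lambda>_. {b}) i) \<inter> space M))"
    by (rule indep_varsD[OF indep_delays_labels]) (use v a b in auto)
  also have "\<dots> = pmf \<mu> a / N"
    using prob_R[OF v] prob_H[OF v b] by simp
  finally have XQ_prob: "prob (?X -` Q \<inter> space M) = pmf \<mu> a / N" .
  have "{\<omega> \<in> meet_event T u x. R v \<omega> = a \<and> H v \<omega> = b} =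
      (\<lambda>\<omega>. (?X \<omega>, window_values ?W \<omega>)) -` (Q \<times> S) \<inter> space M"
    using XQ unfolding S(2) by auto
  then show ?thesis
    using indep_varD[OF ind Q S(1)] unfolding XQ_prob S(2) by simp
qed

text \<open>Moving one step along the line of the later vertex. The delays are bounded by the cut-off, which
  makes the sum finite.\<close>

lemma prob_meet_event_step:
  assumes u: "u \<in> V" "u \<noteq> v" "fst u \<le> fst v" and v: "v \<in> V"
  shows "prob (meet_event T u v) =
    (\<Sum>a=1..nat (fst v - T). pmf \<mu> a / N * (\<Sum>b=1..N. prob (meet_event T u (fst v - int a, b))))"
proof -
  let ?I = "{1..nat (fst v - T)} \<times> {1..N}"
  let ?x = "\<lambda>p. (fst v - int (fst p), snd p)"
  let ?E = "\<lambda>p. {\<omega> \<in> meet_event T u (?x p). R v \<omega> = fst p \<and> H v \<omega> = snd p}"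
  have x: "?x p \<in> V" "?x p \<noteq> v" "fst (?x p) \<le> fst v" if "p \<in> ?I" for p
    using that by (auto simp: seedbank_vertices_def) (cases v; auto)
  have ev: "?E p \<in> events" if "p \<in> ?I" for p
  proof -
    have "?E p = meet_event T u (?x p) \<inter> (R v -` {fst p} \<inter> space M) \<inter> (H v -` {snd p} \<inter> space M)"
      by (auto simp: meet_event_def)
    also have "\<dots> \<in> events"
      by (intro sets.Int[OF sets.Int] meet_event_sets R_event[OF v] H_event[OF v] u(1) x(1)[OF that])
    finally show ?thesis .
  qed
  have "meet_event T u v = (\<Union>p\<in>?I. ?E p)"
  proof (intro equalityI subsetI)
    fix \<omega> assume "\<omega> \<in> meet_event T u v"
    then have \<omega>: "\<omega> \<in> space M" and "lines_meet_above T (\<lambda>v. R v \<omega>) (\<lambda>v. H v \<omega>) u v"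
      by (auto simp: meet_event_def)
    then have m: "lines_meet_above T (\<lambda>v. R v \<omega>) (\<lambda>v. H v \<omega>) u (fst v - int (R v \<omega>), H v \<omega>)"
      by (subst (asm) lines_meet_above_step[OF config[OF \<omega>] u]) (simp add: seedbank_parent_def)
    have RH: "1 \<le> R v \<omega>" "H v \<omega> \<in> {1..N}"
      by (rule R_range[OF v \<omega>], rule H_range[OF v \<omega>])
    then have "T \<le> fst v - int (R v \<omega>)"
      using not_lines_meet_above[OF config[OF \<omega>] u(1), of "(fst v - int (R v \<omega>), H v \<omega>)" T] m
      by (force simp: seedbank_vertices_def)
    with RH m \<omega> show "\<omega> \<in> (\<Union>p\<in>?I. ?E p)"
      by (intro UN_I[of "(R v \<omega>, H v \<omega>)"]) (auto simp: meet_event_def)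
  next
    fix \<omega> assume "\<omega> \<in> (\<Union>p\<in>?I. ?E p)"
    then obtain p where p: "\<omega> \<in> space M" "R v \<omega> = fst p" "H v \<omega> = snd p"
      "lines_meet_above T (\<lambda>v. R v \<omega>) (\<lambda>v. H v \<omega>) u (?x p)"
      by (auto simp: meet_event_def)
    then show "\<omega> \<in> meet_event T u v"
      by (simp add: meet_event_def lines_meet_above_step[OF config[OF p(1)] u] seedbank_parent_def)
  qed
  then have "prob (meet_event T u v) = prob (\<Union>p\<in>?I. ?E p)" by simp
  also have "\<dots> = (\<Sum>p\<in>?I. prob (?E p))"
    by (rule finite_measure_finite_Union)
      (use ev in \<open>auto simp: disjoint_family_on_def prod_eq_iff\<close>)
  also have "\<dots> = (\<Sum>p\<in>?I. pmf \<mu> (fst p) / N * prob (meet_event T u (?x p)))"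
    by (rule sum.cong[OF refl], rule prob_step_meet_event[OF u x v]) auto
  also have "\<dots> = (\<Sum>a=1..nat (fst v - T). pmf \<mu> a / N * (\<Sum>b=1..N. prob (meet_event T u (fst v - int a, b))))"
    by (simp add: sum.cartesian_product' sum_distrib_left)
  finally show ?thesis .
qed

end

section \<open>The renewal equation\<close>

lemma renewal_weight_0: "renewal_weight \<mu> 0 = 1"
proof -
  interpret product_prob_space "\<lambda>_. measure_pmf \<mu>" "UNIV :: nat set" ..
  have "{r :: nat \<Rightarrow> nat. \<exists>j. (\<Sum>i<j. r i) = 0} = space (Pi\<^sub>M UNIV (\<lambda>_::nat. measure_pmf \<mu>))"
    by (auto simp: space_PiM intro: exI[of _ 0])
  then show ?thesis unfolding renewal_weight_def
    by (simp add: prob_space.prob_space[OF prob_space_PiM] measure_pmf.prob_space_axioms)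
qed

lemma renewal_weight_nonneg: "0 \<le> renewal_weight \<mu> n"
  unfolding renewal_weight_def by simp

text \<open>Conditioning on the first delay: the sequence shifted by one is again i.i.d.\<close>

lemma renewal_equation:
  assumes \<mu>: "set_pmf \<mu> \<subseteq> {1..}" and n: "1 \<le> n"
  shows "renewal_weight \<mu> n = (\<Sum>a=1..n. pmf \<mu> a * renewal_weight \<mu> (n - a))"
proof -
  interpret sequence_space "measure_pmf \<mu>" ..
  let ?hits = "\<lambda>n. {r :: nat \<Rightarrow> nat. \<exists>j. (\<Sum>i<j. r i) = n}"
  have hits: "?hits n \<in> sets S" for n
  proof -
    have "(\<lambda>r. \<Sum>i<j. r i) \<in> S \<rightarrow>\<^sub>M count_space UNIV" for j
      by (intro measurable_sum_nat) simp
    then have "{r \<in> space S. \<exists>j. (\<Sum>i<j. r i) = n} \<in> sets S" by measurable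
    then show ?thesis by (simp add: space_PiM)
  qed
  have shift: "case_nat a r \<in> ?hits n \<longleftrightarrow> a \<le> n \<and> r \<in> ?hits (n - a)" for a and r :: "nat \<Rightarrow> nat"
  proof
    assume "case_nat a r \<in> ?hits n"
    then obtain j where j: "(\<Sum>i<j. case_nat a r i) = n" by auto
    with n obtain j' where "j = Suc j'" by (cases j) auto
    with j have "a + (\<Sum>i<j'. r i) = n" by (simp add: sum.lessThan_Suc_shift del: sum.lessThan_Suc)
    then show "a \<le> n \<and> r \<in> ?hits (n - a)" by auto
  next
    assume "a \<le> n \<and> r \<in> ?hits (n - a)"
    then obtain j where "a \<le> n" "(\<Sum>i<j. r i) = n - a" by auto
    then have "(\<Sum>i<Suc j. case_nat a r i) = n" by (simp add: sum.lessThan_Suc_shift del: sum.lessThan_Suc)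
    then show "case_nat a r \<in> ?hits n" by blast
  qed
  have "emeasure S (?hits n) = emeasure (distr (measure_pmf \<mu> \<Otimes>\<^sub>M S) S (\<lambda>(s, \<omega>). case_nat s \<omega>)) (?hits n)"
    by (simp add: PiM_iter)
  also have "\<dots> = emeasure (measure_pmf \<mu> \<Otimes>\<^sub>M S) ((\<lambda>(s, \<omega>). case_nat s \<omega>) -` ?hits n \<inter> space (measure_pmf \<mu> \<Otimes>\<^sub>M S))"
    by (intro emeasure_distr hits) measurable
  also have "\<dots> = (\<integral>\<^sup>+a. emeasure S (Pair a -` ((\<lambda>(s, \<omega>). case_nat s \<omega>) -` ?hits n \<inter> space (measure_pmf \<mu> \<Otimes>\<^sub>M S))) \<partial>measure_pmf \<mu>)"
    by (intro P.emeasure_pair_measure_alt measurable_sets[OF _ hits]) measurable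
  also have "\<dots> = (\<integral>\<^sup>+a. (if a \<le> n then ennreal (renewal_weight \<mu> (n - a)) else 0) \<partial>measure_pmf \<mu>)"
  proof (rule nn_integral_cong)
    fix a
    have "Pair a -` ((\<lambda>(s, \<omega>). case_nat s \<omega>) -` ?hits n \<inter> space (measure_pmf \<mu> \<Otimes>\<^sub>M S)) =
      (if a \<le> n then ?hits (n - a) else {})"
      using shift by (auto simp: space_pair_measure space_PiM)
    then show "emeasure S (Pair a -` ((\<lambda>(s, \<omega>). case_nat s \<omega>) -` ?hits n \<inter> space (measure_pmf \<mu> \<Otimes>\<^sub>M S))) =
       (if a \<le> n then ennreal (renewal_weight \<mu> (n - a)) else 0)"
      unfolding renewal_weight_def by (simp add: P.emeasure_eq_measure)
  qed
  also have "\<dots> = (\<integral>\<^sup>+a. ennreal (if a \<le> n then renewal_weight \<mu> (n - a) else 0) \<partial>measure_pmf \<mu>)"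
    by (intro nn_integral_cong) simp
  also have "\<dots> = ennreal (\<integral>a. (if a \<le> n then renewal_weight \<mu> (n - a) else 0) \<partial>measure_pmf \<mu>)"
  proof (rule nn_integral_eq_integral)
    show "integrable (measure_pmf \<mu>) (\<lambda>a. if a \<le> n then renewal_weight \<mu> (n - a) else 0)"
      by (rule measure_pmf.integrable_const_bound[where B = 1])
        (auto simp: renewal_weight_def)
  qed (simp add: renewal_weight_nonneg)
  also have "(\<integral>a. (if a \<le> n then renewal_weight \<mu> (n - a) else 0) \<partial>measure_pmf \<mu>) =
     (\<Sum>a=1..n. pmf \<mu> a * renewal_weight \<mu> (n - a))"
  proof (subst integral_measure_pmf_real[of "{1..n}"])
    show "(\<Sum>a=1..n. (if a \<le> n then renewal_weight \<mu> (n - a) else 0) * pmf \<mu> a) =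
       (\<Sum>a=1..n. pmf \<mu> a * renewal_weight \<mu> (n - a))"
      by (intro sum.cong) auto
  qed (use \<mu> in \<open>auto split: if_splits\<close>)
  finally show ?thesis
    by (simp add: P.emeasure_eq_measure renewal_weight_def sum_nonneg)
qed

section \<open>The Green function of two independent lines\<close>

text \<open>The renewal weights are extended by 0 to negative arguments, so that convolutions need no case
  distinction on the order of the two times.\<close>

definition ext_weight :: "nat pmf \<Rightarrow> int \<Rightarrow> real" where
  "ext_weight \<mu> x = (if x < 0 then 0 else renewal_weight \<mu> (nat x))"

lemma ext_weight_nonneg: "0 \<le> ext_weight \<mu> x"
  by (simp add: ext_weight_def renewal_weight_nonneg)

lemma ext_weight_renewal:
  assumes \<mu>: "set_pmf \<mu> \<subseteq> {1..}" and K: "x \<le> int K"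
  shows "(\<Sum>a=1..K. pmf \<mu> a * ext_weight \<mu> (x - int a)) = ext_weight \<mu> x - of_bool (x = 0)"
proof (cases "x \<le> 0")
  case True
  then show ?thesis by (auto simp: ext_weight_def renewal_weight_0)
next
  case False
  define n where "n = nat x"
  have x: "x = int n" "1 \<le> n" using False by (auto simp: n_def)
  have "(\<Sum>a=1..K. pmf \<mu> a * ext_weight \<mu> (x - int a)) = (\<Sum>a=1..n. pmf \<mu> a * ext_weight \<mu> (x - int a))"
    using K x by (intro sum.mono_neutral_right) (auto simp: ext_weight_def)
  also have "\<dots> = (\<Sum>a=1..n. pmf \<mu> a * renewal_weight \<mu> (n - a))"
    using x by (intro sum.cong) (auto simp: ext_weight_def nat_diff_distrib)
  also have "\<dots> = renewal_weight \<mu> n" using renewal_equation[OF \<mu> x(2)] by simp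
  finally show ?thesis using x by (simp add: ext_weight_def)
qed

text \<open>The expected number of times in \<open>{T..}\<close> that are visited by both of two independent lines started at
  times \<open>a\<close> and \<open>b\<close>; times after the earlier starting point contribute 0.\<close>

definition common_times :: "nat pmf \<Rightarrow> int \<Rightarrow> int \<Rightarrow> int \<Rightarrow> real" where
  "common_times \<mu> T a b = (\<Sum>t\<in>{T..a}. ext_weight \<mu> (a - t) * ext_weight \<mu> (b - t))"

lemma common_times_sym: "common_times \<mu> T a b = common_times \<mu> T b a"
proof -
  have "common_times \<mu> T a b = (\<Sum>t\<in>{T..min a b}. ext_weight \<mu> (a - t) * ext_weight \<mu> (b - t))" for a b
    unfolding common_times_def by (intro sum.mono_neutral_right) (auto simp: ext_weight_def)
  from this[of a b] this[of b a] show ?thesis by (simp add: mult.commute min.commute)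
qed

text \<open>The defect in this recursion stems from \<open>q\<^sub>0 = 1\<close>, the one weight that the renewal equation
  does not cover: it appears when the line that moves starts at a time visited by the other one, and as
  \<open>a \<le> b\<close> this requires \<open>a = b\<close>.\<close>

lemma common_times_step:
  assumes "set_pmf \<mu> \<subseteq> {1..}" and "a \<le> b"
  shows "(\<Sum>s=1..nat (b - T). pmf \<mu> s * common_times \<mu> T a (b - int s)) =
    common_times \<mu> T a b - of_bool (a = b \<and> T \<le> a)"
proof -
  have "(\<Sum>s=1..nat (b - T). pmf \<mu> s * common_times \<mu> T a (b - int s)) =
    (\<Sum>t\<in>{T..a}. ext_weight \<mu> (a - t) * (\<Sum>s=1..nat (b - T). pmf \<mu> s * ext_weight \<mu> ((b - t) - int s)))"
    unfolding common_times_def sum_distrib_left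
    by (subst sum.swap) (simp add: algebra_simps)
  also have "\<dots> = (\<Sum>t\<in>{T..a}. ext_weight \<mu> (a - t) * (ext_weight \<mu> (b - t) - of_bool (b - t = 0)))"
    by (intro sum.cong refl arg_cong2[where f = "(*)"] ext_weight_renewal[OF assms(1)]) auto
  also have "\<dots> = common_times \<mu> T a b - (\<Sum>t\<in>{T..a}. ext_weight \<mu> (a - t) * of_bool (b = t))"
    unfolding common_times_def by (simp add: algebra_simps sum_subtractf)
  also have "(\<Sum>t\<in>{T..a}. ext_weight \<mu> (a - t) * of_bool (b = t)) = of_bool (a = b \<and> T \<le> a)"
  proof -
    have "(\<Sum>t\<in>{T..a}. ext_weight \<mu> (a - t) * of_bool (b = t)) =
       (\<Sum>t\<in>{T..a}. if t = b then ext_weight \<mu> (a - b) else 0)"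
      by (intro sum.cong) auto
    also have "\<dots> = (if b \<in> {T..a} then ext_weight \<mu> (a - b) else 0)"
      by (rule sum.delta) simp
    also have "\<dots> = of_bool (a = b \<and> T \<le> a)"
      using assms(2) by (auto simp: ext_weight_def renewal_weight_0)
    finally show ?thesis .
  qed
  finally show ?thesis .
qed

text \<open>The expected number of common vertices at or above \<open>T\<close> of two independent lines started at \<open>u\<close>
  and \<open>v\<close>. At every common time the labels agree with probability \<open>1 / N\<close>, except at a common
  starting time, where the labels are given; that time is therefore removed from the count and
  replaced by whether \<open>u = v\<close>.\<close>

definition green :: "nat \<Rightarrow> nat pmf \<Rightarrow> int \<Rightarrow> vertex \<Rightarrow> vertex \<Rightarrow> real" where
  "green N \<mu> T u v = (common_times \<mu> T (fst u) (fst v)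
      - of_bool (fst u = fst v \<and> T \<le> fst u)) / N + of_bool (u = v \<and> T \<le> fst u)"

lemma green_sym: "green N \<mu> T u v = green N \<mu> T v u"
proof -
  have "(fst u = fst v \<and> T \<le> fst u) = (fst v = fst u \<and> T \<le> fst v)"
    and "(u = v \<and> T \<le> fst u) = (v = u \<and> T \<le> fst v)"
    by auto
  then show ?thesis
    unfolding green_def common_times_sym[of \<mu> T "fst u" "fst v"] by (simp only:)
qed

lemma green_nonneg: "0 \<le> green N \<mu> T u v"
proof -
  define P where "P \<longleftrightarrow> fst u = fst v \<and> T \<le> fst u"
  have "of_bool P \<le> common_times \<mu> T (fst u) (fst v)"
  proof (cases P)
    case True
    then have "1 = ext_weight \<mu> (fst u - fst u) * ext_weight \<mu> (fst v - fst u)"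
      by (simp add: P_def ext_weight_def renewal_weight_0)
    also have "\<dots> \<le> common_times \<mu> T (fst u) (fst v)"
      unfolding common_times_def using True
      by (intro member_le_sum) (auto simp: P_def ext_weight_nonneg)
    finally show ?thesis using True by simp
  next
    case False
    have "0 \<le> common_times \<mu> T (fst u) (fst v)"
      unfolding common_times_def by (intro sum_nonneg) (simp add: ext_weight_nonneg)
    then show ?thesis using False by simp
  qed
  then show ?thesis unfolding green_def P_def[symmetric] by simp
qed

text \<open>Averaging over the label of one starting point makes the labels agree with probability \<open>1 / N\<close> at
  a common starting time too, and the correction terms cancel.\<close>

lemma green_sum_labels:
  assumes "1 \<le> N" "snd u \<in> {1..N}"
  shows "(\<Sum>b=1..N. green N \<mu> T u (c, b)) = common_times \<mu> T (fst u) c"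
proof -
  have "(\<Sum>b=1..N. of_bool (u = (c, b) \<and> T \<le> fst u)) = (of_bool (fst u = c \<and> T \<le> fst u) :: real)"
  proof -
    have "(\<Sum>b=1..N. of_bool (u = (c, b) \<and> T \<le> fst u)) =
      (\<Sum>b=1..N. if b = snd u then of_bool (fst u = c \<and> T \<le> fst u) else (0::real))"
      by (intro sum.cong) (cases u; auto)+
    then show ?thesis using assms(2) by (simp add: sum.delta)
  qed
  then show ?thesis unfolding green_def fst_conv sum.distrib
    using assms(1) by simp
qed

lemma green_step:
  assumes "set_pmf \<mu> \<subseteq> {1..}" "1 \<le> N" "snd u \<in> {1..N}" "u \<noteq> v" "fst u \<le> fst v"
  shows "green N \<mu> T u v =
    (\<Sum>a=1..nat (fst v - T). pmf \<mu> a / N * (\<Sum>b=1..N. green N \<mu> T u (fst v - int a, b)))"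
proof -
  have "(\<Sum>a=1..nat (fst v - T). pmf \<mu> a / N * (\<Sum>b=1..N. green N \<mu> T u (fst v - int a, b))) =
    (\<Sum>a=1..nat (fst v - T). pmf \<mu> a * common_times \<mu> T (fst u) (fst v - int a)) / N"
    unfolding green_sum_labels[OF assms(2,3)] by (simp add: sum_divide_distrib)
  also have "\<dots> = green N \<mu> T u v"
    unfolding common_times_step[OF assms(1,5)] green_def using assms(4) by simp
  finally show ?thesis ..
qed

text \<open>A minimum principle. Moving the later of two vertices to an earlier time lowers the total height of
  the pair above \<open>T\<close>, so the induction ends on the diagonal or below \<open>T\<close>. Only an inequality is
  asked for in the recursion, so that the sum over delays may be truncated.\<close>

lemma two_line_comparison:
  fixes D :: "vertex \<Rightarrow> vertex \<Rightarrow> real"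
  assumes sym: "\<And>u v. D u v = D v u"
    and diag: "\<And>u. u \<in> seedbank_vertices N \<Longrightarrow> 0 \<le> D u u"
    and below: "\<And>u v. u \<in> seedbank_vertices N \<Longrightarrow> v \<in> seedbank_vertices N \<Longrightarrow>
       fst u < T \<or> fst v < T \<Longrightarrow> 0 \<le> D u v"
    and step: "\<And>u v. u \<in> seedbank_vertices N \<Longrightarrow> v \<in> seedbank_vertices N \<Longrightarrow> u \<noteq> v \<Longrightarrow>
       T \<le> fst u \<Longrightarrow> fst u \<le> fst v \<Longrightarrow>
       (\<Sum>a=1..K v. pmf \<mu> a / N * (\<Sum>b=1..N. D u (fst v - int a, b))) \<le> D u v"
    and "u \<in> seedbank_vertices N" "v \<in> seedbank_vertices N"
  shows "0 \<le> D u v"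
  using assms(5,6)
proof (induction "nat (fst u - T) + nat (fst v - T)" arbitrary: u v rule: less_induct)
  case less
  have *: "0 \<le> D u v" if uv: "u \<in> seedbank_vertices N" "v \<in> seedbank_vertices N"
    and le: "fst u \<le> fst v" "T \<le> fst u" "u \<noteq> v"
    and IH: "\<And>x. x \<in> seedbank_vertices N \<Longrightarrow> T \<le> fst x \<Longrightarrow> fst x < fst v \<Longrightarrow> 0 \<le> D u x" for u v
  proof -
    have "0 \<le> D u (fst v - int a, b)" if "a \<in> {1..K v}" "b \<in> {1..N}" for a b
    proof (cases "fst v - int a < T")
      case True
      then show ?thesis using that uv by (intro below) (auto simp: seedbank_vertices_def)
    next
      case False
      then show ?thesis using that by (intro IH) (auto simp: seedbank_vertices_def)
    qed
    then have "0 \<le> (\<Sum>a=1..K v. pmf \<mu> a / N * (\<Sum>b=1..N. D u (fst v - int a, b)))"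
      by (intro sum_nonneg mult_nonneg_nonneg) auto
    then show ?thesis using step[OF uv le(3,2,1)] by linarith
  qed
  consider "u = v" | "fst u < T \<or> fst v < T" | "u \<noteq> v" "T \<le> fst u" "T \<le> fst v" by linarith
  then show ?case
  proof cases
    case 3
    show ?thesis
    proof (cases "fst u \<le> fst v")
      case True
      then show ?thesis
        using less 3 by (intro *[of u v]) auto
    next
      case False
      then have "0 \<le> D v u"
        using less 3 sym by (intro *[of v u]) (auto simp: sym[of v])
      then show ?thesis by (simp add: sym)
    qed
  qed (use less diag below in auto)
qed

section \<open>The meeting probability\<close>

lemma common_times_eq_sum:
  assumes "T \<le> a"
  shows "common_times \<mu> T a (a + int i) =
    (\<Sum>m\<le>nat (a - T). renewal_weight \<mu> m * renewal_weight \<mu> (m + i))"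
proof -
  have "nat (a + int i - t) = nat (a - t) + i" if "t \<le> a" for t using that by linarith
  then show ?thesis
    unfolding common_times_def using assms
    by (intro sum.reindex_bij_witness[of _ "\<lambda>m. a - int m" "\<lambda>t. nat (a - t)"])
      (auto simp: ext_weight_def)
qed

lemma green_diag:
  assumes "T \<le> fst u"
  shows "green N \<mu> T u u = 1 + (\<Sum>m<nat (fst u - T). (renewal_weight \<mu> (Suc m))\<^sup>2) / N"
proof -
  have "common_times \<mu> T (fst u) (fst u) = (\<Sum>m\<le>nat (fst u - T). (renewal_weight \<mu> m)\<^sup>2)"
    using common_times_eq_sum[OF assms, of \<mu> 0] by (simp add: power2_eq_square)
  also have "\<dots> = 1 + (\<Sum>m<nat (fst u - T). (renewal_weight \<mu> (Suc m))\<^sup>2)"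
    by (subst sum.atMost_shift) (simp add: renewal_weight_0)
  finally show ?thesis using assms by (simp add: green_def)
qed

lemma green_eq_0: "fst u < T \<Longrightarrow> green N \<mu> T u v = 0"
  by (simp add: green_def common_times_def)

context long_range_seedbank
begin

lemma prob_meet_event_diag: "u \<in> V \<Longrightarrow> prob (meet_event T u u) = of_bool (T \<le> fst u)"
proof (cases "T \<le> fst u")
  case True
  then have "meet_event T u u = space M" by (auto simp: meet_event_def lines_meet_above_refl)
  with True show ?thesis by (simp add: prob_space)
next
  case False
  assume "u \<in> V"
  with False have "meet_event T u u = {}" using not_lines_meet_above[OF config]
    unfolding meet_event_def by (auto simp: not_le)
  with False show ?thesis by simp
qed

lemma meet_event_below:
  "u \<in> V \<Longrightarrow> v \<in> V \<Longrightarrow> fst u < T \<or> fst v < T \<Longrightarrow> meet_event T u v = {}"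
  using not_lines_meet_above[OF config] unfolding meet_event_def by blast

lemma meet_event_sym: "meet_event T u v = meet_event T v u"
  unfolding meet_event_def using lines_meet_above_sym by blast

text \<open>On the diagonal above \<open>T\<close> the meeting probability is 1 and the number of common vertices is at most its value
  without cut-off, the constant on the right. Below \<open>T\<close> both quantities vanish.\<close>

lemma green_le_prob_meet:
  assumes \<mu>: "set_pmf \<mu> \<subseteq> {1..}" and uv: "u \<in> V" "v \<in> V"
    and sq: "summable (\<lambda>m. (renewal_weight \<mu> (Suc m))\<^sup>2)"
  shows "green N \<mu> T u v \<le> (1 + (\<Sum>m. (renewal_weight \<mu> (Suc m))\<^sup>2) / N) * prob (meet_event T u v)"
proof -
  define C where "C = 1 + (\<Sum>m. (renewal_weight \<mu> (Suc m))\<^sup>2) / N"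
  define D where "D u v = C * prob (meet_event T u v) - green N \<mu> T u v" for u v
  have N: "1 \<le> N" using uv by (auto simp: seedbank_vertices_def)
  have C0: "0 \<le> C" unfolding C_def using sq by (auto intro!: add_nonneg_nonneg divide_nonneg_nonneg suminf_nonneg)
  have "0 \<le> D u v"
  proof (rule two_line_comparison[where D = D and T = T and N = N and \<mu> = \<mu>
        and K = "\<lambda>v. nat (fst v - T)", OF _ _ _ _ uv])
    show "D u v = D v u" for u v
      unfolding D_def green_sym[of _ _ _ u v] meet_event_sym[of _ u v] ..
    show "0 \<le> D u u" if "u \<in> V" for u
    proof (cases "T \<le> fst u")
      case True
      have "(\<Sum>m<nat (fst u - T). (renewal_weight \<mu> (Suc m))\<^sup>2) \<le> (\<Sum>m. (renewal_weight \<mu> (Suc m))\<^sup>2)"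
        by (rule sum_le_suminf[OF sq]) auto
      then show ?thesis unfolding D_def C_def green_diag[OF True] prob_meet_event_diag[OF that]
        using True by (simp add: divide_right_mono)
    qed (simp add: D_def green_eq_0 C0)
    show "0 \<le> D u v" if "fst u < T \<or> fst v < T" for u v
    proof -
      have "green N \<mu> T u v = 0"
        using that green_eq_0[of u T N \<mu> v] green_eq_0[of v T N \<mu> u] green_sym[of N \<mu> T u v] by auto
      then show ?thesis unfolding D_def using C0 by simp
    qed
    show "(\<Sum>a=1..nat (fst v - T). pmf \<mu> a / N * (\<Sum>b=1..N. D u (fst v - int a, b))) \<le> D u v"
      if "u \<in> V" "v \<in> V" "u \<noteq> v" "T \<le> fst u" "fst u \<le> fst v" for u v
    proof -
      have u: "snd u \<in> {1..N}" using that by (auto simp: seedbank_vertices_def)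
      show ?thesis
        unfolding D_def prob_meet_event_step[OF that(1,3,5,2)] green_step[OF \<mu> N u that(3,5)]
        by (simp add: sum_subtractf sum_distrib_left algebra_simps)
    qed
  qed
  then show ?thesis by (simp add: D_def C_def)
qed

text \<open>The number of common vertices is counted down to a time \<open>T'\<close> below the cut-off \<open>T\<close> for meeting.
  Lines that meet above \<open>T\<close> then have at least \<open>T - T'\<close> further time units in which to meet again,
  which bounds the count on the diagonal from below.\<close>

lemma prob_meet_le_green:
  assumes \<mu>: "set_pmf \<mu> \<subseteq> {1..}" and uv: "u \<in> V" "v \<in> V" and T': "T' \<le> T"
  shows "(1 + (\<Sum>m<nat (T - T'). (renewal_weight \<mu> (Suc m))\<^sup>2) / N) * prob (meet_event T u v)
     \<le> green N \<mu> T' u v"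
proof -
  define C where "C = 1 + (\<Sum>m<nat (T - T'). (renewal_weight \<mu> (Suc m))\<^sup>2) / N"
  define D where "D u v = green N \<mu> T' u v - C * prob (meet_event T u v)" for u v
  have N: "1 \<le> N" using uv by (auto simp: seedbank_vertices_def)
  have "0 \<le> D u v"
  proof (rule two_line_comparison[where D = D and T = T and N = N and \<mu> = \<mu>
        and K = "\<lambda>v. nat (fst v - T)", OF _ _ _ _ uv])
    show "D u v = D v u" for u v
      unfolding D_def green_sym[of _ _ _ u v] meet_event_sym[of _ u v] ..
    show "0 \<le> D u u" if "u \<in> V" for u
    proof (cases "T \<le> fst u")
      case True
      have "(\<Sum>m<nat (T - T'). (renewal_weight \<mu> (Suc m))\<^sup>2) \<le>
          (\<Sum>m<nat (fst u - T'). (renewal_weight \<mu> (Suc m))\<^sup>2)"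
        using True T' by (intro sum_mono2) auto
      moreover have "T' \<le> fst u" using True T' by simp
      ultimately show ?thesis unfolding D_def C_def prob_meet_event_diag[OF that]
        using True by (simp add: green_diag divide_right_mono)
    qed (use that in \<open>simp add: D_def meet_event_below green_nonneg\<close>)
    show "0 \<le> D u v" if "u \<in> V" "v \<in> V" "fst u < T \<or> fst v < T" for u v
      unfolding D_def meet_event_below[OF that] by (simp add: green_nonneg)
    show "(\<Sum>a=1..nat (fst v - T). pmf \<mu> a / N * (\<Sum>b=1..N. D u (fst v - int a, b))) \<le> D u v"
      if "u \<in> V" "v \<in> V" "u \<noteq> v" "T \<le> fst u" "fst u \<le> fst v" for u v
    proof -
      have u: "snd u \<in> {1..N}" using that by (auto simp: seedbank_vertices_def)
      have "(\<Sum>a=1..nat (fst v - T). pmf \<mu> a / N * (\<Sum>b=1..N. D u (fst v - int a, b))) =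
         (\<Sum>a=1..nat (fst v - T). pmf \<mu> a / N * (\<Sum>b=1..N. green N \<mu> T' u (fst v - int a, b)))
          - C * prob (meet_event T u v)"
        unfolding D_def prob_meet_event_step[OF that(1,3,5,2)]
        by (simp add: sum_subtractf sum_distrib_left algebra_simps)
      also have "(\<Sum>a=1..nat (fst v - T). pmf \<mu> a / N * (\<Sum>b=1..N. green N \<mu> T' u (fst v - int a, b)))
        \<le> (\<Sum>a=1..nat (fst v - T'). pmf \<mu> a / N * (\<Sum>b=1..N. green N \<mu> T' u (fst v - int a, b)))"
        using T' by (intro sum_mono2) (auto intro!: mult_nonneg_nonneg sum_nonneg green_nonneg divide_nonneg_nonneg)
      also have "\<dots> = green N \<mu> T' u v"
        unfolding green_step[OF \<mu> N u that(3,5)] ..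
      finally show ?thesis by (simp add: D_def)
    qed
  qed
  then show ?thesis by (simp add: D_def C_def)
qed

text \<open>The two preceding bounds, with the cut-offs sent to \<open>-\<infinity>\<close>. In the upper bound the counting
  cut-off is sent there first, with that for meeting held fixed at \<open>- n\<close>.\<close>

theorem prob_same_component:
  assumes \<mu>: "set_pmf \<mu> \<subseteq> {1..}" and k: "k \<in> {1..N}" and l: "l \<in> {1..N}" and i: "1 \<le> i"
    and sq: "summable (\<lambda>m. (renewal_weight \<mu> m)\<^sup>2)"
  shows "prob {\<omega> \<in> space M. same_component N (\<lambda>v. R v \<omega>) (\<lambda>v. H v \<omega>) (0, k) (int i, l)} =
    (\<Sum>m. renewal_weight \<mu> m * renewal_weight \<mu> (m + i)) /
    (N + (\<Sum>m. (renewal_weight \<mu> (Suc m))\<^sup>2))"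
proof -
  let ?q = "renewal_weight \<mu>" and ?u = "(0::int, k)" and ?v = "(int i, l)"
  define C where "C = 1 + (\<Sum>m. (?q (Suc m))\<^sup>2) / N"
  define S where "S = (\<Sum>m. ?q m * ?q (m + i))"
  define p where "p n = prob (meet_event (- int n) ?u ?v)" for n
  define P where "P = prob (\<Union>n. meet_event (- int n) ?u ?v)"
  have u: "?u \<in> V" "?v \<in> V" using k l by (auto simp: seedbank_vertices_def)
  have N: "1 \<le> N" using k by simp
  have sq': "summable (\<lambda>m. (?q (Suc m))\<^sup>2)" 
    using summable_ignore_initial_segment[OF sq, of 1] by simp
  have prod: "summable (\<lambda>m. ?q m * ?q (m + i))"
    by (rule summable_shifted_product[OF renewal_weight_nonneg sq])
  have green: "green N \<mu> (- int n) ?u ?v = (\<Sum>m\<le>n. ?q m * ?q (m + i)) / N" for n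
    using common_times_eq_sum[of "- int n" 0 \<mu> i] i by (simp add: green_def)
  have green_lim: "(\<lambda>n. green N \<mu> (- int n) ?u ?v) \<longlonglongrightarrow> S / N"
    unfolding green S_def using prod N by (intro tendsto_divide summable_LIMSEQ') auto
  have p_lim: "p \<longlonglongrightarrow> P"
    unfolding p_def P_def
  proof (rule finite_Lim_measure_incseq)
    show "range (\<lambda>n. meet_event (- int n) ?u ?v) \<subseteq> events" using meet_event_sets[OF u] by auto
    show "incseq (\<lambda>n. meet_event (- int n) ?u ?v)"
    proof (rule incseq_SucI)
      show "meet_event (- int n) ?u ?v \<subseteq> meet_event (- int (Suc n)) ?u ?v" for n
        unfolding meet_event_def lines_meet_above_def by fastforce
    qed
  qed
  have "S / N \<le> C * P"
  proof (rule LIMSEQ_le[OF green_lim tendsto_mult[OF tendsto_const p_lim]])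
    show "\<exists>K. \<forall>n\<ge>K. green N \<mu> (- int n) ?u ?v \<le> C * p n"
      unfolding C_def p_def using green_le_prob_meet[OF \<mu> u sq'] by blast
  qed
  moreover have "C * P \<le> S / N"
  proof (rule LIMSEQ_le_const2[OF tendsto_mult[OF tendsto_const p_lim]], intro exI[of _ 0] allI impI)
    fix n :: nat
    have "(\<lambda>n'. (1 + (\<Sum>m<n'. (?q (Suc m))\<^sup>2) / N) * p n) \<longlonglongrightarrow> C * p n"
      unfolding C_def using sq' N by (intro tendsto_intros summable_LIMSEQ) auto
    moreover have "(\<lambda>n'. green N \<mu> (- int (n' + n)) ?u ?v) \<longlonglongrightarrow> S / N"
      using LIMSEQ_ignore_initial_segment[OF green_lim, of n] .
    moreover have "(1 + (\<Sum>m<n'. (?q (Suc m))\<^sup>2) / N) * p n \<le> green N \<mu> (- int (n' + n)) ?u ?v" for n'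
      using prob_meet_le_green[OF \<mu> u, of "- int (n' + n)" "- int n"] by (simp add: p_def)
    ultimately show "C * p n \<le> S / N" by (intro LIMSEQ_le) auto
  qed
  ultimately have "C * P = S / N" by simp
  moreover have "0 < real N + (\<Sum>m. (?q (Suc m))\<^sup>2)"
    using N suminf_nonneg[OF sq'] by simp
  ultimately have "P = S / (N + (\<Sum>m. (?q (Suc m))\<^sup>2))"
    unfolding C_def using N by (simp add: field_simps)
  moreover have "{\<omega> \<in> space M. same_component N (\<lambda>v. R v \<omega>) (\<lambda>v. H v \<omega>) ?u ?v} =
      (\<Union>n. meet_event (- int n) ?u ?v)"
    using same_component_iff_lines_meet[OF config u] unfolding meet_event_def by auto
  ultimately show ?thesis by (simp add: P_def S_def)
qed

end

section \<open>The asymptotics of the meeting probability\<close>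

text \<open>The reciprocal is taken to obtain an increasing sequence with positive index. A decreasing sequence
  that is eventually positive is positive throughout, so the division is harmless.\<close>

lemma regularly_varying_tail:
  fixes T :: "nat \<Rightarrow> real"
  assumes \<alpha>: "0 < \<alpha>" and L: "slowly_varying L" and anti: "antimono T"
    and T: "T \<sim>[at_top] (\<lambda>n. real n powr (- \<alpha>) * L (real n))"
  shows "monotone_regularly_varying (\<lambda>n. 1 / T n) \<alpha>"
    and "(\<lambda>n. T n / (real n powr (- \<alpha>) * L (real n))) \<longlonglongrightarrow> 1"
proof -
  define g where "g n = real n powr (- \<alpha>) * L (real n)" for n :: nat
  have Lpos: "0 < L x" for x using L by (simp add: slowly_varying_def)
  have g: "0 < g n" if "1 \<le> n" for n using that Lpos by (simp add: g_def)
  have lim: "(\<lambda>n. T n / g n) \<longlonglongrightarrow> 1"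
    unfolding g_def
  proof (rule asymp_equivD_strong[OF T])
    show "\<forall>\<^sub>F n in sequentially. T n \<noteq> 0 \<or> real n powr (- \<alpha>) * L (real n) \<noteq> 0"
      using eventually_ge_at_top[of 1] by eventually_elim (use Lpos in \<open>simp add: less_imp_neq[symmetric]\<close>)
  qed
  then show "(\<lambda>n. T n / (real n powr (- \<alpha>) * L (real n))) \<longlonglongrightarrow> 1" by (simp add: g_def)
  have pos: "0 < T n" for n
  proof -
    have "\<forall>\<^sub>F m in sequentially. 0 < T m / g m \<and> 1 \<le> m \<and> n \<le> m"
      using order_tendstoD(1)[OF lim, of 0] eventually_ge_at_top by (intro eventually_conj) auto
    then obtain m where "0 < T m / g m" "1 \<le> m" "n \<le> m" using eventually_happens by fastforce
    then show ?thesis using g[of m] antimonoD[OF anti, of n m] by (simp add: zero_less_divide_iff)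
  qed
  show "monotone_regularly_varying (\<lambda>n. 1 / T n) \<alpha>"
  proof
    show "mono (\<lambda>n. 1 / T n)"
      using pos antimonoD[OF anti] by (intro monoI divide_left_mono) auto
    show "0 < 1 / T n" for n using pos by simp
    show "0 < \<alpha>" by fact
    fix c :: nat assume c: "1 \<le> c"
    have cn: "filterlim (\<lambda>n. c * n) at_top sequentially"
      using c by (intro filterlim_subseq) (auto simp: strict_mono_def)
    have "(\<lambda>n. L (real c * real n) / L (real n)) \<longlonglongrightarrow> 1"
      using L c filterlim_compose[OF _ filterlim_real_sequentially, of "\<lambda>x. L (real c * x) / L x"]
      by (auto simp: slowly_varying_def)
    then have "(\<lambda>n. (T n / g n) / (T (c * n) / g (c * n)) * (real c powr \<alpha> / (L (real c * real n) / L (real n))))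
        \<longlonglongrightarrow> 1 / 1 * (real c powr \<alpha> / 1)"
      by (intro tendsto_mult tendsto_divide lim filterlim_compose[OF lim cn] tendsto_const) auto
    moreover have "\<forall>\<^sub>F n in sequentially.
        (T n / g n) / (T (c * n) / g (c * n)) * (real c powr \<alpha> / (L (real c * real n) / L (real n))) =
        (1 / T (c * n)) / (1 / T n)"
      using eventually_ge_at_top[of 1]
    proof eventually_elim
      case (elim n)
      have "g (c * n) = g n * (L (real c * real n) / L (real n)) / real c powr \<alpha>"
        using Lpos[of "real n"] c by (simp add: g_def powr_mult powr_minus field_simps)
      then show ?case
        using Lpos[of "real n"] Lpos[of "real c * real n"] g[OF elim] pos[of n] pos[of "c * n"] c
        by simp
    qed
    ultimately show "(\<lambda>n. (1 / T (c * n)) / (1 / T n)) \<longlonglongrightarrow> real c powr \<alpha>"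
      by (auto intro: Lim_transform_eventually)
  qed
qed

theorem proposition10p1:
  fixes \<alpha> :: real and L :: "real \<Rightarrow> real" and \<mu> :: "nat pmf" and N :: nat
    and M :: "'w measure" and R H :: "vertex \<Rightarrow> 'w \<Rightarrow> nat" and k l :: nat
  assumes "0 < \<alpha>" and "\<alpha> < 1 / 2"
    and "slowly_varying L"
    and "set_pmf \<mu> \<subseteq> {1..}"
    and "(\<lambda>n. measure_pmf.prob \<mu> {n..}) \<sim>[at_top] (\<lambda>n. real n powr (- \<alpha>) * L (real n))"
    and "Gcd {n. pmf \<mu> n > 0} = 1"
    and "renewal_weight \<mu> \<sim>[at_top]
           (\<lambda>n. 1 / (Gamma \<alpha> * Gamma (1 - \<alpha>)) * (real n powr (\<alpha> - 1) / L (real n)))"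
    and "N \<ge> 1"
    and "long_range_seedbank M N \<mu> R H"
    and "k \<in> {1..N}" and "l \<in> {1..N}"
  shows "(\<lambda>i::nat. measure M
            {\<omega> \<in> space M. same_component N (\<lambda>v. R v \<omega>) (\<lambda>v. H v \<omega>) (0, k) (int i, l)})
         \<sim>[at_top]
         (\<lambda>i. (1 / (real N + (\<Sum>m. (renewal_weight \<mu> (Suc m))\<^sup>2)) *
               (Gamma (1 - 2 * \<alpha>) / (Gamma \<alpha> * Gamma (1 - \<alpha>) ^ 3))) *
              (real i powr (2 * \<alpha> - 1) / (L (real i))\<^sup>2))"
proof -
  interpret long_range_seedbank M N \<mu> R H by fact
  define T where "T n = measure_pmf.prob \<mu> {n..}" for n
  define c where "c = 1 / (Gamma \<alpha> * Gamma (1 - \<alpha>))"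
  define D where "D = real N + (\<Sum>m. (renewal_weight \<mu> (Suc m))\<^sup>2)"
  define S where "S i = (\<Sum>m. renewal_weight \<mu> m * renewal_weight \<mu> (m + i))" for i
  have Lpos: "0 < L x" for x using assms(3) by (simp add: slowly_varying_def)
  have Gpos: "0 < Gamma \<alpha>" "0 < Gamma (1 - \<alpha>)" "0 < Gamma (1 - 2 * \<alpha>)"
    using assms(1,2) by (auto intro!: Gamma_real_pos)
  have c: "0 < c" using Gpos by (simp add: c_def)
  have "antimono T" unfolding T_def by (intro antimonoI measure_pmf.finite_measure_mono) auto
  note tail = regularly_varying_tail[OF assms(1,3) this assms(5)[folded T_def]]
  interpret W: monotone_regularly_varying "\<lambda>n. 1 / T n" \<alpha> by (rule tail(1))
  have Tpos: "0 < T n" for n using W.pos[of n] by simp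
  have q_lim: "(\<lambda>n. renewal_weight \<mu> n * real n / (1 / T n)) \<longlonglongrightarrow> c"
  proof -
    have "(\<lambda>n. renewal_weight \<mu> n / (c * (real n powr (\<alpha> - 1) / L (real n)))) \<longlonglongrightarrow> 1"
    proof (rule asymp_equivD_strong)
      show "\<forall>\<^sub>F n in sequentially. renewal_weight \<mu> n \<noteq> 0 \<or> c * (real n powr (\<alpha> - 1) / L (real n)) \<noteq> 0"
        using eventually_ge_at_top[of 1]
        by eventually_elim (use c Lpos in \<open>simp add: less_imp_neq[symmetric]\<close>)
    qed (use assms(7) in \<open>simp add: c_def\<close>)
    then have "(\<lambda>n. renewal_weight \<mu> n / (c * (real n powr (\<alpha> - 1) / L (real n))) *
        (T n / (real n powr (- \<alpha>) * L (real n))) * c) \<longlonglongrightarrow> 1 * 1 * c"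
      by (intro tendsto_mult tail(2) tendsto_const)
    moreover have "\<forall>\<^sub>F n in sequentially. renewal_weight \<mu> n / (c * (real n powr (\<alpha> - 1) / L (real n))) *
        (T n / (real n powr (- \<alpha>) * L (real n))) * c = renewal_weight \<mu> n * real n / (1 / T n)"
      using eventually_ge_at_top[of 1]
    proof eventually_elim
      case (elim n)
      have "real n powr (\<alpha> - 1) * real n powr (- \<alpha>) = real n powr ((\<alpha> - 1) + - \<alpha>)"
        by (rule powr_add[symmetric])
      also have "\<dots> = 1 / real n" using elim by (simp add: powr_minus_divide)
      finally have *: "real n powr (\<alpha> - 1) = 1 / (real n * real n powr (- \<alpha>))"
        using elim by (simp add: nonzero_eq_divide_eq powr_eq_0_iff mult_ac)
      show ?case unfolding * using elim c Lpos[of "real n"] by simp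
    qed
    ultimately show ?thesis by (auto intro: Lim_transform_eventually)
  qed
  have sq: "summable (\<lambda>m. (renewal_weight \<mu> m)\<^sup>2)"
    by (rule W.summable_square[OF renewal_weight_nonneg q_lim assms(2)])
  have D: "0 < D"
    unfolding D_def using assms(8) summable_ignore_initial_segment[OF sq, of 1]
    by (intro add_pos_nonneg suminf_nonneg) auto
  have conv: "(\<lambda>i. S i * real i / (1 / T i)\<^sup>2) \<longlonglongrightarrow> c\<^sup>2 * Beta \<alpha> (1 - 2 * \<alpha>)"
    unfolding S_def by (rule W.shifted_convolution_tendsto[OF renewal_weight_nonneg q_lim assms(2)])
  have "(\<lambda>i. S i * real i / (1 / T i)\<^sup>2 / D / (T i / (real i powr (- \<alpha>) * L (real i)))\<^sup>2)
      \<longlonglongrightarrow> c\<^sup>2 * Beta \<alpha> (1 - 2 * \<alpha>) / D / 1\<^sup>2"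
    using D by (intro tendsto_divide tendsto_power conv tail(2) tendsto_const) auto
  moreover have "\<forall>\<^sub>F i in sequentially.
      S i * real i / (1 / T i)\<^sup>2 / D / (T i / (real i powr (- \<alpha>) * L (real i)))\<^sup>2 =
      prob {\<omega> \<in> space M. same_component N (\<lambda>v. R v \<omega>) (\<lambda>v. H v \<omega>) (0, k) (int i, l)} /
        (real i powr (2 * \<alpha> - 1) / (L (real i))\<^sup>2)"
    using eventually_ge_at_top[of 1]
  proof eventually_elim
    case (elim i)
    have P: "prob {\<omega> \<in> space M. same_component N (\<lambda>v. R v \<omega>) (\<lambda>v. H v \<omega>) (0, k) (int i, l)} = S i / D"
      unfolding S_def D_def by (rule prob_same_component[OF assms(4,10,11) elim sq])
    have "real i powr (2 * \<alpha> - 1) * (real i powr (- \<alpha>))\<^sup>2 =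
        real i powr ((2 * \<alpha> - 1) + (- \<alpha> + - \<alpha>))"
      by (simp only: power2_eq_square powr_add)
    also have "\<dots> = 1 / real i" using elim by (simp add: powr_minus_divide)
    finally have *: "real i powr (2 * \<alpha> - 1) = 1 / (real i * (real i powr (- \<alpha>))\<^sup>2)"
      using elim by (simp add: nonzero_eq_divide_eq powr_eq_0_iff mult_ac)
    show ?case
      unfolding P * using elim Tpos[of i] Lpos[of "real i"]
      by (simp add: power_divide power_mult_distrib)
  qed
  ultimately have "(\<lambda>i. prob {\<omega> \<in> space M. same_component N (\<lambda>v. R v \<omega>) (\<lambda>v. H v \<omega>) (0, k) (int i, l)} /
        (real i powr (2 * \<alpha> - 1) / (L (real i))\<^sup>2)) \<longlonglongrightarrow> c\<^sup>2 * Beta \<alpha> (1 - 2 * \<alpha>) / D / 1\<^sup>2"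
    by (rule Lim_transform_eventually)
  also have "c\<^sup>2 * Beta \<alpha> (1 - 2 * \<alpha>) / D / 1\<^sup>2 = 1 / D * (Gamma (1 - 2 * \<alpha>) / (Gamma \<alpha> * Gamma (1 - \<alpha>) ^ 3))"
  proof -
    have "\<alpha> + (1 - 2 * \<alpha>) = 1 - \<alpha>" by simp
    then show ?thesis
      using Gpos by (simp add: c_def Beta_def power2_eq_square power3_eq_cube)
  qed
  finally show ?thesis
    using D Gpos unfolding D_def[symmetric] by (intro asymp_equivI'_const) auto
qed

end
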